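(* Let $X=\ell_\Phi$ be a Musielak--Orlicz sequence space, where $\Phi$ is non-degenerate and $h_\Phi\cong\ell_\Phi$. Let $f:X\to\mathbb{R}\cup\{+\infty\}$ be proper, lower semicontinuous, bounded below, and with bounded domain $S:=\{x\in X:f(x)<\infty\}$. Then there exists a dense $G_\delta$ subset $X_0^*\subset X^*$ such that for every $x^*\in X_0^*$ the function $f-x^*$ attains a strong minimum on $X$.
   Context: An Orlicz function is an even, continuous, convex function $M:\mathbb{R}\to\mathbb{R}$, nondecreasing on $[0,\infty)$ with $M(0)=0$; it is non-degenerate if $M(t)>0$ for all $t>0$. A Musielak--Orlicz function is a sequence $\Phi=\{\Phi_i\}_{i=1}^\infty$ of Orlicz functions; it is non-degenerate if every $\Phi_i$ is. The modular is $\widetilde\Phi(x)=\sum_{i=1}^\infty\Phi_i(x_i)$. $\ell_\Phi$ is the space of real sequences $x$ with $\widetilde\Phi(\lambda x)<\infty$ for some $\lambda>0$, with the Luxemburg norm $\|x\|_\Phi=\inf\{r>0:\widetilde\Phi(x/r)\le 1\}$. $h_\Phi$ is the closed linear subspace of $\ell_\Phi$ generated by all $x\in\ell_\Phi$ with $\widetilde\Phi(\lambda x)<\infty$ for every $\lambda>0$. $h_\Phi\cong\ell_\Phi$ means that the two spaces coincide. A function $g$ attains a strong minimum at $z$ if $g$ attains its minimum at $z$ and every minimizing sequence of $g$ converges in norm to $z$. *)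

theory Defs
  imports "HOL-Analysis.Analysis"
begin

definition orlicz :: "(real \<Rightarrow> real) \<Rightarrow> bool" where
  "orlicz M \<longleftrightarrow> (\<forall>t. M (- t) = M t) \<and> continuous_on UNIV M \<and> convex_on UNIV M
     \<and> mono_on {0..} M \<and> M 0 = 0"

definition nondegenerate :: "(real \<Rightarrow> real) \<Rightarrow> bool" where
  "nondegenerate M \<longleftrightarrow> (\<forall>t>0. M t > 0)"

text \<open>Sequences are indexed from 0.\<close>

definition musielak_orlicz :: "(nat \<Rightarrow> real \<Rightarrow> real) \<Rightarrow> bool" where
  "musielak_orlicz \<Phi> \<longleftrightarrow> (\<forall>i. orlicz (\<Phi> i))"

definition mo_nondegenerate :: "(nat \<Rightarrow> real \<Rightarrow> real) \<Rightarrow> bool" where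
  "mo_nondegenerate \<Phi> \<longleftrightarrow> (\<forall>i. nondegenerate (\<Phi> i))"

text \<open>Orlicz functions are nonnegative, so the truncation made by \<^const>\<open>ennreal\<close> is harmless.\<close>

definition modular :: "(nat \<Rightarrow> real \<Rightarrow> real) \<Rightarrow> (nat \<Rightarrow> real) \<Rightarrow> ennreal" where
  "modular \<Phi> x = (\<Sum>i. ennreal (\<Phi> i (x i)))"

definition mo_space :: "(nat \<Rightarrow> real \<Rightarrow> real) \<Rightarrow> (nat \<Rightarrow> real) set" where
  "mo_space \<Phi> = {x. \<exists>c>0. modular \<Phi> (\<lambda>i. c * x i) < \<infinity>}"

definition mo_norm :: "(nat \<Rightarrow> real \<Rightarrow> real) \<Rightarrow> (nat \<Rightarrow> real) \<Rightarrow> real" where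
  "mo_norm \<Phi> x = Inf {r. r > 0 \<and> modular \<Phi> (\<lambda>i. x i / r) \<le> 1}"

text \<open>The locale \<^locale>\<open>Metric_space\<close> demands nonnegativity and symmetry of the distance also off
  the carrier, where the infimum is taken over the empty set; hence the value 0 there (the same
  applies to \<open>dual_dist\<close> below).\<close>

definition mo_dist :: "(nat \<Rightarrow> real \<Rightarrow> real) \<Rightarrow> (nat \<Rightarrow> real) \<Rightarrow> (nat \<Rightarrow> real) \<Rightarrow> real" where
  "mo_dist \<Phi> x y =
     (if x \<in> mo_space \<Phi> \<and> y \<in> mo_space \<Phi> then mo_norm \<Phi> (\<lambda>i. x i - y i) else 0)"

definition mo_top :: "(nat \<Rightarrow> real \<Rightarrow> real) \<Rightarrow> (nat \<Rightarrow> real) topology" where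
  "mo_top \<Phi> = Metric_space.mtopology (mo_space \<Phi>) (mo_dist \<Phi>)"

definition seq_subspace :: "(nat \<Rightarrow> real) set \<Rightarrow> bool" where
  "seq_subspace V \<longleftrightarrow> (\<lambda>i. 0) \<in> V \<and> (\<forall>x\<in>V. \<forall>y\<in>V. (\<lambda>i. x i + y i) \<in> V)
     \<and> (\<forall>c. \<forall>x\<in>V. (\<lambda>i. c * x i) \<in> V)"

definition mo_h :: "(nat \<Rightarrow> real \<Rightarrow> real) \<Rightarrow> (nat \<Rightarrow> real) set" where
  "mo_h \<Phi> = \<Inter>{V. seq_subspace V \<and> closedin (mo_top \<Phi>) V \<and>
     {x \<in> mo_space \<Phi>. \<forall>c>0. modular \<Phi> (\<lambda>i. c * x i) < \<infinity>} \<subseteq> V}"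

text \<open>A functional is made extensional so that it is determined by its values on the space.\<close>

definition mo_dual :: "(nat \<Rightarrow> real \<Rightarrow> real) \<Rightarrow> ((nat \<Rightarrow> real) \<Rightarrow> real) set" where
  "mo_dual \<Phi> = {\<phi> \<in> extensional (mo_space \<Phi>).
     (\<forall>x\<in>mo_space \<Phi>. \<forall>y\<in>mo_space \<Phi>. \<phi> (\<lambda>i. x i + y i) = \<phi> x + \<phi> y) \<and>
     (\<forall>c. \<forall>x\<in>mo_space \<Phi>. \<phi> (\<lambda>i. c * x i) = c * \<phi> x) \<and>
     (\<exists>C. \<forall>x\<in>mo_space \<Phi>. \<bar>\<phi> x\<bar> \<le> C * mo_norm \<Phi> x)}"

definition dual_norm ::
    "(nat \<Rightarrow> real \<Rightarrow> real) \<Rightarrow> ((nat \<Rightarrow> real) \<Rightarrow> real) \<Rightarrow> real" where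
  "dual_norm \<Phi> \<phi> = (SUP x\<in>{x \<in> mo_space \<Phi>. mo_norm \<Phi> x \<le> 1}. \<bar>\<phi> x\<bar>)"

definition dual_dist ::
    "(nat \<Rightarrow> real \<Rightarrow> real) \<Rightarrow> ((nat \<Rightarrow> real) \<Rightarrow> real) \<Rightarrow> ((nat \<Rightarrow> real) \<Rightarrow> real) \<Rightarrow> real" where
  "dual_dist \<Phi> \<phi> \<psi> =
     (if \<phi> \<in> mo_dual \<Phi> \<and> \<psi> \<in> mo_dual \<Phi> then dual_norm \<Phi> (\<lambda>x. \<phi> x - \<psi> x) else 0)"

definition dual_top :: "(nat \<Rightarrow> real \<Rightarrow> real) \<Rightarrow> ((nat \<Rightarrow> real) \<Rightarrow> real) topology" where
  "dual_top \<Phi> = Metric_space.mtopology (mo_dual \<Phi>) (dual_dist \<Phi>)"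

definition lower_semicontinuous :: "'a topology \<Rightarrow> ('a \<Rightarrow> ereal) \<Rightarrow> bool" where
  "lower_semicontinuous T f \<longleftrightarrow> (\<forall>c. openin T {x \<in> topspace T. c < f x})"

definition strong_minimum ::
    "(nat \<Rightarrow> real \<Rightarrow> real) \<Rightarrow> ((nat \<Rightarrow> real) \<Rightarrow> ereal) \<Rightarrow> (nat \<Rightarrow> real) \<Rightarrow> bool" where
  "strong_minimum \<Phi> g z \<longleftrightarrow> z \<in> mo_space \<Phi> \<and> (\<forall>x\<in>mo_space \<Phi>. g z \<le> g x) \<and>
     (\<forall>u. range u \<subseteq> mo_space \<Phi> \<and> (\<lambda>n. g (u n)) \<longlonglongrightarrow> (INF x\<in>mo_space \<Phi>. g x)
        \<longrightarrow> (\<lambda>n. mo_norm \<Phi> (\<lambda>i. u n i - z i)) \<longlonglongrightarrow> 0)"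

subsection \<open>The distances are metrics\<close>

lemma orlicz_nonneg: "orlicz M \<Longrightarrow> 0 \<le> M t"
proof -
  assume M: "orlicz M"
  have "M \<bar>t\<bar> = M t" using M by (auto simp: orlicz_def abs_if)
  moreover have "M 0 \<le> M \<bar>t\<bar>" using M mono_onD[of "{0..}" M 0 "\<bar>t\<bar>"] unfolding orlicz_def by auto
  ultimately show ?thesis using M by (simp add: orlicz_def)
qed

lemma orlicz_conv:
  assumes "orlicz M" "0 \<le> u" "0 \<le> v" "u + v \<le> 1"
  shows "M (u * a + v * b) \<le> u * M a + v * M b"
proof -
  have cv: "convex_on UNIV M" and z: "M 0 = 0" using assms by (auto simp: orlicz_def)
  show ?thesis
  proof (cases "u + v = 0")
    case True
    then have "u = 0" "v = 0" using assms by auto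
    then show ?thesis using z by simp
  next
    case False
    define s where "s = u + v"
    have s: "0 < s" "s \<le> 1" using False assms s_def by auto
    have "u / s + v / s = 1" using s s_def by (simp add: add_divide_distrib[symmetric])
    moreover have "0 \<le> u / s" "0 \<le> v / s" using s assms by auto
    ultimately have A: "M (u / s * a + v / s * b) \<le> u / s * M a + v / s * M b"
      using convex_onD[OF cv, of "v / s" a b] by (simp add: eq_diff_eq[symmetric])
    have "M (s * (u / s * a + v / s * b)) \<le> s * M (u / s * a + v / s * b)"
      using convex_onD[OF cv, of s 0 "u / s * a + v / s * b"] s z by simp
    also have "\<dots> \<le> s * (u / s * M a + v / s * M b)" using A s by simp
    finally show ?thesis using s by (simp add: distrib_left)
  qed
qed

lemma modular_conv:
  assumes "musielak_orlicz \<Phi>" "0 \<le> u" "0 \<le> v" "u + v \<le> 1"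
  shows "modular \<Phi> (\<lambda>i. u * x i + v * y i)
           \<le> ennreal u * modular \<Phi> x + ennreal v * modular \<Phi> y"
proof -
  have o: "orlicz (\<Phi> i)" for i using assms(1) by (simp add: musielak_orlicz_def)
  have "modular \<Phi> (\<lambda>i. u * x i + v * y i)
      \<le> (\<Sum>i. ennreal u * ennreal (\<Phi> i (x i)) + ennreal v * ennreal (\<Phi> i (y i)))"
    unfolding modular_def
  proof (intro suminf_le)
    fix i
    show "ennreal (\<Phi> i (u * x i + v * y i))
        \<le> ennreal u * ennreal (\<Phi> i (x i)) + ennreal v * ennreal (\<Phi> i (y i))"
      using orlicz_conv[OF o assms(2-4)] orlicz_nonneg[OF o] assms(2,3)
      by (simp flip: ennreal_mult ennreal_plus add: ennreal_leI)
  qed auto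
  also have "\<dots> = ennreal u * modular \<Phi> x + ennreal v * modular \<Phi> y"
    by (simp add: modular_def suminf_add[symmetric])
  finally show ?thesis .
qed

lemma mo_space_zero: "musielak_orlicz \<Phi> \<Longrightarrow> (\<lambda>i. 0) \<in> mo_space \<Phi>"
  unfolding mo_space_def
  by (auto simp: modular_def musielak_orlicz_def orlicz_def intro!: exI[of _ 1])

lemma mo_space_add:
  assumes "musielak_orlicz \<Phi>" "x \<in> mo_space \<Phi>" "y \<in> mo_space \<Phi>"
  shows "(\<lambda>i. x i + y i) \<in> mo_space \<Phi>"
proof -
  obtain l m where l: "l > 0" "modular \<Phi> (\<lambda>i. l * x i) < \<infinity>"
    and m: "m > 0" "modular \<Phi> (\<lambda>i. m * y i) < \<infinity>"
    using assms by (auto simp: mo_space_def)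
  define k where "k = l * m / (l + m)"
  have k: "k > 0" using l m by (simp add: k_def)
  have eq: "k * (x i + y i) = m / (l + m) * (l * x i) + l / (l + m) * (m * y i)" for i
  proof -
    have "m / (l + m) * (l * x i) = k * x i" "l / (l + m) * (m * y i) = k * y i"
      by (simp_all add: k_def mult_ac)
    then show ?thesis by (simp add: distrib_left)
  qed
  have "modular \<Phi> (\<lambda>i. k * (x i + y i)) \<le> ennreal (m / (l + m)) * modular \<Phi> (\<lambda>i. l * x i)
      + ennreal (l / (l + m)) * modular \<Phi> (\<lambda>i. m * y i)"
    unfolding eq using l m
    by (intro modular_conv assms) (auto simp: add_divide_distrib[symmetric])
  also have "\<dots> < \<infinity>" using l m by (simp add: ennreal_mult_less_top)
  finally show ?thesis using k by (auto simp: mo_space_def)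
qed

lemma modular_neg: "musielak_orlicz \<Phi> \<Longrightarrow> modular \<Phi> (\<lambda>i. - x i) = modular \<Phi> x"
  by (simp add: modular_def musielak_orlicz_def orlicz_def)

lemma mo_space_scale:
  assumes "musielak_orlicz \<Phi>" "x \<in> mo_space \<Phi>"
  shows "(\<lambda>i. c * x i) \<in> mo_space \<Phi>"
proof -
  obtain l where l: "l > 0" "modular \<Phi> (\<lambda>i. l * x i) < \<infinity>" using assms by (auto simp: mo_space_def)
  consider "c = 0" | "c > 0" | "c < 0" by linarith
  then show ?thesis
  proof cases
    case 1
    then show ?thesis using mo_space_zero[OF assms(1)] by simp
  next
    case 2
    then have "modular \<Phi> (\<lambda>i. (l / c) * (c * x i)) < \<infinity>" "l / c > 0" using l by simp_all
    then show ?thesis unfolding mo_space_def by blast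
  next
    case 3
    then have "(\<lambda>i. (l / - c) * (c * x i)) = (\<lambda>i. - (l * x i))" by auto
    then have "modular \<Phi> (\<lambda>i. (l / - c) * (c * x i)) < \<infinity>"
      using l modular_neg[OF assms(1), of "\<lambda>i. l * x i"] by (simp only:)
    moreover have "l / - c > 0" using 3 l by (simp add: divide_pos_neg)
    ultimately show ?thesis unfolding mo_space_def by blast
  qed
qed

lemma mo_space_diff:
  assumes "musielak_orlicz \<Phi>" "x \<in> mo_space \<Phi>" "y \<in> mo_space \<Phi>"
  shows "(\<lambda>i. x i - y i) \<in> mo_space \<Phi>"
  using mo_space_add[OF assms(1,2) mo_space_scale[OF assms(1,3), of "-1"]] by simp

lemma mo_norm_ne:
  assumes "musielak_orlicz \<Phi>" "x \<in> mo_space \<Phi>"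
  shows "{r. r > 0 \<and> modular \<Phi> (\<lambda>i. x i / r) \<le> 1} \<noteq> {}"
proof -
  obtain l where l: "l > 0" "modular \<Phi> (\<lambda>i. l * x i) < \<infinity>" using assms by (auto simp: mo_space_def)
  then obtain C where C: "C \<ge> 0" "modular \<Phi> (\<lambda>i. l * x i) = ennreal C"
    by (cases "modular \<Phi> (\<lambda>i. l * x i)") auto
  define D where "D = 1 + C"
  have D: "D \<ge> 1" "C \<le> D" using C D_def by auto
  have "modular \<Phi> (\<lambda>i. 1 / D * (l * x i) + 0 * 0)
      \<le> ennreal (1 / D) * modular \<Phi> (\<lambda>i. l * x i) + ennreal 0 * modular \<Phi> (\<lambda>i. 0)"
    using D by (intro modular_conv assms) auto
  also have "\<dots> = ennreal (C / D)" using C D by (simp add: ennreal_mult[symmetric])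
  also have "\<dots> \<le> 1" using C D by (simp add: divide_le_eq)
  finally have "modular \<Phi> (\<lambda>i. x i / (D / l)) \<le> 1" by (simp add: field_simps)
  moreover have "D / l > 0" using l D by simp
  ultimately show ?thesis by blast
qed

lemma mo_norm_bdd: "bdd_below {r::real. r > 0 \<and> P r}"
  by (rule bdd_belowI[of _ 0]) auto

lemma mo_norm_nonneg:
  assumes "musielak_orlicz \<Phi>" "x \<in> mo_space \<Phi>"
  shows "0 \<le> mo_norm \<Phi> x"
  unfolding mo_norm_def using mo_norm_ne[OF assms] by (intro cInf_greatest) auto

lemma mo_norm_less:
  assumes "musielak_orlicz \<Phi>" "x \<in> mo_space \<Phi>" "mo_norm \<Phi> x < e"
  obtains r where "0 < r" "r < e" "modular \<Phi> (\<lambda>i. x i / r) \<le> 1"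
  using assms(3) cInf_less_iff[OF mo_norm_ne[OF assms(1,2)] mo_norm_bdd, of e]
  unfolding mo_norm_def by auto

lemma mo_norm_le: "0 < r \<Longrightarrow> modular \<Phi> (\<lambda>i. x i / r) \<le> 1 \<Longrightarrow> mo_norm \<Phi> x \<le> r"
  unfolding mo_norm_def by (rule cInf_lower[OF _ mo_norm_bdd]) auto

lemma mo_norm_triangle:
  assumes "musielak_orlicz \<Phi>" "x \<in> mo_space \<Phi>" "y \<in> mo_space \<Phi>"
  shows "mo_norm \<Phi> (\<lambda>i. x i + y i) \<le> mo_norm \<Phi> x + mo_norm \<Phi> y"
proof (rule field_le_epsilon)
  fix e :: real assume e: "e > 0"
  obtain r where r: "0 < r" "r < mo_norm \<Phi> x + e / 2" "modular \<Phi> (\<lambda>i. x i / r) \<le> 1"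
    using mo_norm_less[OF assms(1,2), of "mo_norm \<Phi> x + e / 2"] e by auto
  obtain s where s: "0 < s" "s < mo_norm \<Phi> y + e / 2" "modular \<Phi> (\<lambda>i. y i / s) \<le> 1"
    using mo_norm_less[OF assms(1,3), of "mo_norm \<Phi> y + e / 2"] e by auto
  have eq: "(x i + y i) / (r + s) = r / (r + s) * (x i / r) + s / (r + s) * (y i / s)" for i
    using r s by (simp add: add_divide_distrib)
  have "modular \<Phi> (\<lambda>i. (x i + y i) / (r + s))
      \<le> ennreal (r / (r + s)) * modular \<Phi> (\<lambda>i. x i / r)
        + ennreal (s / (r + s)) * modular \<Phi> (\<lambda>i. y i / s)"
    unfolding eq using r s
    by (intro modular_conv assms) (auto simp: add_divide_distrib[symmetric])
  also have "\<dots> \<le> ennreal (r / (r + s)) * 1 + ennreal (s / (r + s)) * 1"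
    using r s by (intro add_mono mult_left_mono) auto
  also have "\<dots> = 1"
    using r s by (simp flip: ennreal_plus add: add_divide_distrib[symmetric])
  finally have "mo_norm \<Phi> (\<lambda>i. x i + y i) \<le> r + s" using r s by (intro mo_norm_le) auto
  then show "mo_norm \<Phi> (\<lambda>i. x i + y i) \<le> mo_norm \<Phi> x + mo_norm \<Phi> y + e" using r s by linarith
qed

lemma mo_norm_neg:
  assumes "musielak_orlicz \<Phi>"
  shows "mo_norm \<Phi> (\<lambda>i. - x i) = mo_norm \<Phi> x"
  using modular_neg[OF assms, of "\<lambda>i. x i / r" for r] by (simp add: mo_norm_def)

lemma mo_norm_zero: "musielak_orlicz \<Phi> \<Longrightarrow> mo_norm \<Phi> (\<lambda>i. 0) = 0"
proof -
  assume a: "musielak_orlicz \<Phi>"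
  have "modular \<Phi> (\<lambda>i. 0) = 0"
    using a by (simp add: modular_def musielak_orlicz_def orlicz_def)
  then have "mo_norm \<Phi> (\<lambda>i. 0) \<le> 0 + e" if "e > 0" for e using that by (intro mo_norm_le) auto
  then have "mo_norm \<Phi> (\<lambda>i. 0) \<le> 0" by (rule field_le_epsilon)
  then show ?thesis using mo_norm_nonneg[OF a mo_space_zero[OF a]] by simp
qed

lemma mo_norm_eq_0:
  assumes a: "musielak_orlicz \<Phi>" "mo_nondegenerate \<Phi>" "x \<in> mo_space \<Phi>" and n: "mo_norm \<Phi> x = 0"
  shows "x = (\<lambda>i. 0)"
proof (rule ccontr)
  assume "x \<noteq> (\<lambda>i. 0)"
  then obtain i where i: "x i \<noteq> 0" by auto
  have o: "orlicz (\<Phi> i)" using a by (simp add: musielak_orlicz_def)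
  have "\<Phi> i (x i) = \<Phi> i \<bar>x i\<bar>" using o by (auto simp: orlicz_def abs_if)
  then have pos: "\<Phi> i (x i) > 0" using a i by (simp add: mo_nondegenerate_def nondegenerate_def)
  obtain r where r: "0 < r" "r < min 1 (\<Phi> i (x i))" "modular \<Phi> (\<lambda>i. x i / r) \<le> 1"
    using mo_norm_less[OF a(1,3), of "min 1 (\<Phi> i (x i))"] pos n by auto
  have "ennreal (\<Phi> i (x i / r)) \<le> modular \<Phi> (\<lambda>i. x i / r)"
    using sum_le_suminf[of "\<lambda>i. ennreal (\<Phi> i (x i / r))" "{i}"] by (simp add: modular_def)
  then have "ennreal (\<Phi> i (x i / r)) \<le> 1" using r(3) by (rule order_trans)
  then have "\<Phi> i (x i / r) \<le> 1" by simp
  then have "r * \<Phi> i (x i / r) \<le> r" using r by (intro mult_left_le) auto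
  moreover have "\<Phi> i (r * (x i / r) + 0 * 0) \<le> r * \<Phi> i (x i / r) + 0 * \<Phi> i 0"
    using r by (intro orlicz_conv o) auto
  then have "\<Phi> i (x i) \<le> r * \<Phi> i (x i / r)" using r(1) by simp
  ultimately have "\<Phi> i (x i) \<le> r" by linarith
  then show False using r by simp
qed

lemma mo_metric:
  assumes a: "musielak_orlicz \<Phi>" "mo_nondegenerate \<Phi>"
  shows "Metric_space (mo_space \<Phi>) (mo_dist \<Phi>)"
proof
  show "0 \<le> mo_dist \<Phi> x y" for x y
    using a by (auto simp: mo_dist_def intro: mo_norm_nonneg mo_space_diff)
  show "mo_dist \<Phi> x y = mo_dist \<Phi> y x" for x y
    using mo_norm_neg[OF a(1), of "\<lambda>i. x i - y i"] by (simp add: mo_dist_def)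
  show "mo_dist \<Phi> x y = 0 \<longleftrightarrow> x = y" if "x \<in> mo_space \<Phi>" "y \<in> mo_space \<Phi>" for x y
    using that mo_norm_eq_0[OF a mo_space_diff[OF a(1) that]] mo_norm_zero[OF a(1)]
    by (auto simp: mo_dist_def fun_eq_iff)
  show "mo_dist \<Phi> x z \<le> mo_dist \<Phi> x y + mo_dist \<Phi> y z"
    if "x \<in> mo_space \<Phi>" "y \<in> mo_space \<Phi>" "z \<in> mo_space \<Phi>" for x y z
    using that mo_norm_triangle[OF a(1) mo_space_diff[OF a(1), of x y] mo_space_diff[OF a(1), of y z]]
    by (simp add: mo_dist_def)
qed

lemma dual_bdd:
  assumes a: "musielak_orlicz \<Phi>" and f: "\<phi> \<in> mo_dual \<Phi>" "\<psi> \<in> mo_dual \<Phi>"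
  shows "bdd_above ((\<lambda>x. \<bar>\<phi> x - \<psi> x\<bar>) ` {x \<in> mo_space \<Phi>. mo_norm \<Phi> x \<le> 1})"
proof -
  obtain C D where C: "\<forall>x\<in>mo_space \<Phi>. \<bar>\<phi> x\<bar> \<le> C * mo_norm \<Phi> x"
    and D: "\<forall>x\<in>mo_space \<Phi>. \<bar>\<psi> x\<bar> \<le> D * mo_norm \<Phi> x"
    using f by (auto simp: mo_dual_def)
  show ?thesis
  proof (rule bdd_aboveI2)
    fix x assume x: "x \<in> {x \<in> mo_space \<Phi>. mo_norm \<Phi> x \<le> 1}"
    have n: "0 \<le> mo_norm \<Phi> x" using mo_norm_nonneg[OF a] x by auto
    have "K * mo_norm \<Phi> x \<le> \<bar>K\<bar>" for K
    proof -
      have "K * mo_norm \<Phi> x \<le> \<bar>K\<bar> * mo_norm \<Phi> x" using n by (intro mult_right_mono) auto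
      also have "\<dots> \<le> \<bar>K\<bar> * 1" using x by (intro mult_left_mono) auto
      finally show ?thesis by simp
    qed
    from this[of C] this[of D] show "\<bar>\<phi> x - \<psi> x\<bar> \<le> \<bar>C\<bar> + \<bar>D\<bar>" using C D x by fastforce
  qed
qed

lemma dual_metric:
  assumes a: "musielak_orlicz \<Phi>"
  shows "Metric_space (mo_dual \<Phi>) (dual_dist \<Phi>)"
proof -
  let ?B = "{x \<in> mo_space \<Phi>. mo_norm \<Phi> x \<le> 1}"
  have z: "(\<lambda>i. 0) \<in> ?B" using mo_space_zero[OF a] mo_norm_zero[OF a] by simp
  have up: "\<bar>\<phi> x - \<psi> x\<bar> \<le> dual_dist \<Phi> \<phi> \<psi>"
    if "\<phi> \<in> mo_dual \<Phi>" "\<psi> \<in> mo_dual \<Phi>" "x \<in> ?B" for \<phi> \<psi> x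
    using cSUP_upper[OF that(3) dual_bdd[OF a that(1,2)]] that
    by (simp add: dual_dist_def dual_norm_def)
  have le: "dual_dist \<Phi> \<phi> \<psi> \<le> K"
    if "\<phi> \<in> mo_dual \<Phi>" "\<psi> \<in> mo_dual \<Phi>" "\<And>x. x \<in> ?B \<Longrightarrow> \<bar>\<phi> x - \<psi> x\<bar> \<le> K" for \<phi> \<psi> K
    using that z unfolding dual_dist_def dual_norm_def by (auto intro!: cSUP_least)
  have nn: "0 \<le> dual_dist \<Phi> \<phi> \<psi>" for \<phi> \<psi>
    using up[OF _ _ z, of \<phi> \<psi>] by (cases "\<phi> \<in> mo_dual \<Phi> \<and> \<psi> \<in> mo_dual \<Phi>") (auto simp: dual_dist_def)
  show ?thesis
  proof
    show "0 \<le> dual_dist \<Phi> \<phi> \<psi>" for \<phi> \<psi> by (rule nn)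
    show "dual_dist \<Phi> \<phi> \<psi> = dual_dist \<Phi> \<psi> \<phi>" for \<phi> \<psi>
      by (auto simp: dual_dist_def dual_norm_def abs_minus_commute)
    show "dual_dist \<Phi> \<phi> \<psi> = 0 \<longleftrightarrow> \<phi> = \<psi>" if f: "\<phi> \<in> mo_dual \<Phi>" "\<psi> \<in> mo_dual \<Phi>" for \<phi> \<psi>
    proof
      assume "\<phi> = \<psi>"
      then show "dual_dist \<Phi> \<phi> \<psi> = 0" using le[OF f, of 0] nn[of \<phi> \<psi>] by simp
    next
      assume d: "dual_dist \<Phi> \<phi> \<psi> = 0"
      have "\<phi> x = \<psi> x" if x: "x \<in> mo_space \<Phi>" for x
      proof -
        obtain r where r: "0 < r" "modular \<Phi> (\<lambda>i. x i / r) \<le> 1" using mo_norm_ne[OF a x] by auto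
        have "(\<lambda>i. (1 / r) * x i) \<in> ?B"
          using mo_space_scale[OF a x, of "1 / r"] r mo_norm_le[of 1 \<Phi> "\<lambda>i. x i / r"] by simp
        from up[OF f this] have "\<phi> (\<lambda>i. (1 / r) * x i) = \<psi> (\<lambda>i. (1 / r) * x i)" using d by simp
        moreover have "\<phi> (\<lambda>i. (1 / r) * x i) = (1 / r) * \<phi> x" "\<psi> (\<lambda>i. (1 / r) * x i) = (1 / r) * \<psi> x"
          using f x unfolding mo_dual_def by blast+
        ultimately show ?thesis using r by simp
      qed
      moreover have "\<phi> \<in> extensional (mo_space \<Phi>)" "\<psi> \<in> extensional (mo_space \<Phi>)"
        using f by (auto simp: mo_dual_def)
      ultimately show "\<phi> = \<psi>" by (meson extensionalityI)
    qed
    show "dual_dist \<Phi> \<phi> \<theta> \<le> dual_dist \<Phi> \<phi> \<psi> + dual_dist \<Phi> \<psi> \<theta>"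
      if f: "\<phi> \<in> mo_dual \<Phi>" "\<psi> \<in> mo_dual \<Phi>" "\<theta> \<in> mo_dual \<Phi>" for \<phi> \<psi> \<theta>
    proof (rule le[OF f(1,3)])
      fix x assume x: "x \<in> ?B"
      show "\<bar>\<phi> x - \<theta> x\<bar> \<le> dual_dist \<Phi> \<phi> \<psi> + dual_dist \<Phi> \<psi> \<theta>"
        using up[OF f(1,2) x] up[OF f(2,3) x] by linarith
    qed
  qed
qed

lemma topspace_mo_top:
  "musielak_orlicz \<Phi> \<Longrightarrow> mo_nondegenerate \<Phi> \<Longrightarrow> topspace (mo_top \<Phi>) = mo_space \<Phi>"
  by (simp add: mo_top_def Metric_space.topspace_mtopology mo_metric)

lemma topspace_dual_top: "musielak_orlicz \<Phi> \<Longrightarrow> topspace (dual_top \<Phi>) = mo_dual \<Phi>"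
  by (simp add: dual_top_def Metric_space.topspace_mtopology dual_metric)

end

theory Submission
  imports Defs
begin

text \<open>Let \<open>X0\<close> consist of those \<open>\<phi>\<close> for which the slices
  \<open>{x. f x - \<phi> x < inf (f - \<phi>) + \<delta>}\<close> have arbitrarily small diameter as \<open>\<delta>\<close> tends to 0. The domain being
  bounded, \<open>X0\<close> is a \<open>G\<^sub>\<delta>\<close>; completeness and lower semicontinuity give a strong minimum at each of its
  points. For density it suffices, after replacing \<open>f\<close> by \<open>f - \<phi>\<close>, to find small elements of \<open>X0\<close>. They
  are found, by Baire's theorem, in the complete space \<open>Y\<close> of functionals that are coordinatewise continuous on
  bounded sets; this is the predual. Bounded sequences have coordinatewise convergent subsequences, so for
  \<open>\<psi> \<in> Y\<close> every minimizing sequence of \<open>f - \<psi>\<close> clusters somewhere, and these cluster points are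
  subgradients at \<open>\<psi>\<close> of the convex function \<open>p \<psi> = sup (\<psi> - f)\<close>. As \<open>h\<^sub>\<Phi> = \<ell>\<^sub>\<Phi>\<close> is separable, \<open>Y\<close> is a
  countable union of sets on which some cluster point lies within \<open>e\<close> of a fixed \<open>q\<close>. Where the closure of such a
  set has interior, \<open>p - q\<close> is \<open>e\<close>-Lipschitz, so approximate subgradients, in particular the points of thin
  slices, are close to \<open>q\<close>, because \<open>Y\<close> is norming.\<close>

section \<open>Orlicz functions and coordinatewise convergence\<close>

text \<open>The box \<open>?K\<close> is compact by Tychonoff's theorem. A product over a countable
  index set is first countable, so compactness yields sequential compactness.\<close>

lemma bounded_coordinatewise_convergent_subseq:
  fixes u :: "nat \<Rightarrow> nat \<Rightarrow> real"
  assumes "\<And>j i. \<bar>u j i\<bar> \<le> b i"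
  obtains x r where "strict_mono r" "\<And>i. (\<lambda>j. u (r j) i) \<longlonglongrightarrow> x i"
proof -
  let ?K = "PiE UNIV (\<lambda>i. {- b i..b i})"
  have "compactin (product_topology (\<lambda>i. euclidean) UNIV) ?K"
    by (simp add: compactin_PiE)
  then have "compact ?K"
    by (simp add: euclidean_product_topology)
  then have "seq_compact ?K"
    by (rule compact_imp_seq_compact)
  moreover have "\<forall>j. u j \<in> ?K"
    using assms by (auto simp: PiE_UNIV_domain abs_le_iff minus_le_iff)
  ultimately obtain x r where "strict_mono r" and lim: "(u \<circ> r) \<longlonglongrightarrow> x"
    unfolding seq_compact_def by blast
  have "(\<lambda>j. (u \<circ> r) j i) \<longlonglongrightarrow> x i" for i
    using continuous_on_tendsto_compose[OF continuous_on_product_coordinates[of i] lim] by simp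
  then show ?thesis
    using that[OF \<open>strict_mono r\<close>, of x] by (simp add: comp_def)
qed

lemma orlicz_mono:
  assumes "orlicz M" "\<bar>s\<bar> \<le> \<bar>t\<bar>"
  shows "M s \<le> M t"
proof -
  have "M \<bar>r\<bar> = M r" for r using assms(1) by (auto simp: orlicz_def abs_if)
  moreover have "M \<bar>s\<bar> \<le> M \<bar>t\<bar>"
    using assms mono_onD[of "{0..}" M "\<bar>s\<bar>" "\<bar>t\<bar>"] by (auto simp: orlicz_def)
  ultimately show ?thesis by metis
qed

text \<open>Convexity and \<open>M 0 = 0\<close> give \<open>k * M 1 \<le> M k\<close> for
  \<open>k \<ge> 1\<close>. With \<open>k = 1 + 1 / M 1\<close> the left side is
  \<open>M 1 + 1\<close>, so \<open>M\<close> exceeds 1 from \<open>k\<close> on.\<close>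

lemma orlicz_unbounded:
  assumes "orlicz M" "nondegenerate M"
  obtains T where "T > 0" "\<And>t. M t \<le> 1 \<Longrightarrow> \<bar>t\<bar> \<le> T"
proof
  define k where "k = 1 + 1 / M 1"
  have M1: "M 1 > 0" using assms(2) by (simp add: nondegenerate_def)
  then have k: "k > 1" by (simp add: k_def)
  then show "k > 0" by simp
  fix t assume t: "M t \<le> 1"
  have "M (1 / k * k + 0 * 0) \<le> 1 / k * M k + 0 * M 0"
    using k by (intro orlicz_conv assms) auto
  then have "k * M 1 \<le> M k" using k by (simp add: field_simps)
  then have "1 < M k" using M1 by (simp add: k_def distrib_right)
  then have "\<not> M k \<le> M t" using t by simp
  then have "\<not> \<bar>k\<bar> \<le> \<bar>t\<bar>" using orlicz_mono[OF assms(1)] by blast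
  then show "\<bar>t\<bar> \<le> k" using k by simp
qed

lemma orlicz_subgradient:
  assumes "orlicz M"
  obtains s where "\<And>t. M u + s * (t - u) \<le> M t"
proof -
  have "convex_on UNIV M" using assms by (simp add: orlicz_def)
  from convex_le_Inf_differential[OF this, of u] that show ?thesis by auto
qed

lemma orlicz_small_near_0:
  assumes "orlicz M" "e > 0"
  obtains d where "d > 0" "\<And>t. \<bar>t\<bar> < d \<Longrightarrow> M t \<le> e"
proof -
  have "isCont M 0" "M 0 = 0"
    using assms(1) by (auto simp: orlicz_def continuous_on_eq_continuous_at)
  then have "\<exists>d>0. \<forall>t. dist t 0 < d \<longrightarrow> dist (M t) (M 0) < e"
    using assms(2) unfolding continuous_at_eps_delta by blast
  then obtain d where "d > 0" and d: "\<And>t. \<bar>t\<bar> < d \<Longrightarrow> \<bar>M t\<bar> < e"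
    using \<open>M 0 = 0\<close> by (auto simp: dist_real_def)
  show ?thesis
  proof (rule that[OF \<open>d > 0\<close>])
    show "M t \<le> e" if "\<bar>t\<bar> < d" for t
      using d[OF that] by linarith
  qed
qed

section \<open>The modular and the Luxemburg norm under coordinatewise limits\<close>

lemma modular_le_1_iff:
  assumes "musielak_orlicz \<Phi>"
  shows "modular \<Phi> x \<le> 1 \<longleftrightarrow> (\<forall>n. (\<Sum>i<n. \<Phi> i (x i)) \<le> 1)"
proof -
  have nn: "0 \<le> \<Phi> i (x i)" for i
    using assms orlicz_nonneg by (simp add: musielak_orlicz_def)
  have "modular \<Phi> x = (SUP n. ennreal (\<Sum>i<n. \<Phi> i (x i)))"
    by (simp add: modular_def suminf_eq_SUP nn)
  then show ?thesis by (simp add: SUP_le_iff)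
qed

text \<open>A finite partial sum depends continuously on finitely many coordinates, so each bound
  \<open>\<le> 1\<close> survives the limit.\<close>

lemma modular_le_1_coordinatewise_limit:
  assumes "musielak_orlicz \<Phi>" "\<And>i. (\<lambda>j. u j i) \<longlonglongrightarrow> x i"
    and "eventually (\<lambda>j. modular \<Phi> (u j) \<le> 1) sequentially"
  shows "modular \<Phi> x \<le> 1"
  unfolding modular_le_1_iff[OF assms(1)]
proof
  fix n
  have "isCont (\<Phi> i) t" for i t
    using assms(1) by (simp add: musielak_orlicz_def orlicz_def continuous_on_eq_continuous_at)
  then have "(\<lambda>j. \<Sum>i<n. \<Phi> i (u j i)) \<longlonglongrightarrow> (\<Sum>i<n. \<Phi> i (x i))"
    by (intro tendsto_sum isCont_tendsto_compose[OF _ assms(2)])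
  moreover have "eventually (\<lambda>j. (\<Sum>i<n. \<Phi> i (u j i)) \<le> 1) sequentially"
    using assms(3) by eventually_elim (simp add: modular_le_1_iff[OF assms(1)])
  ultimately show "(\<Sum>i<n. \<Phi> i (x i)) \<le> 1"
    by (rule tendsto_upperbound) simp
qed

lemma modular_finite_support:
  assumes "musielak_orlicz \<Phi>" "\<And>i. i \<ge> n \<Longrightarrow> x i = 0"
  shows "modular \<Phi> x = ennreal (\<Sum>i<n. \<Phi> i (x i))"
proof -
  have nn: "0 \<le> \<Phi> i (x i)" "\<Phi> i 0 = 0" for i
    using assms orlicz_nonneg by (simp_all add: musielak_orlicz_def orlicz_def)
  have "modular \<Phi> x = (\<Sum>i\<in>{..<n}. ennreal (\<Phi> i (x i)))"
    unfolding modular_def using assms nn by (intro suminf_finite) auto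
  then show ?thesis using nn by simp
qed

lemma modular_mono:
  assumes "musielak_orlicz \<Phi>" "\<And>i. \<bar>x i\<bar> \<le> \<bar>y i\<bar>"
  shows "modular \<Phi> x \<le> modular \<Phi> y"
  unfolding modular_def
proof (intro suminf_le ennreal_leI)
  show "\<Phi> i (x i) \<le> \<Phi> i (y i)" for i
    by (rule orlicz_mono) (use assms in \<open>simp_all add: musielak_orlicz_def\<close>)
qed simp_all

text \<open>The norm is an infimum, so some admissible scale \<open>s\<close> lies below
  \<open>r\<close>, and enlarging the scale only decreases the modular.\<close>

lemma modular_le_1_if_norm_less:
  assumes "musielak_orlicz \<Phi>" "x \<in> mo_space \<Phi>" "mo_norm \<Phi> x < r"
  shows "modular \<Phi> (\<lambda>i. x i / r) \<le> 1"
proof -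
  obtain s where s: "0 < s" "s < r" "modular \<Phi> (\<lambda>i. x i / s) \<le> 1"
    using mo_norm_less[OF assms] by blast
  have "modular \<Phi> (\<lambda>i. x i / r) \<le> modular \<Phi> (\<lambda>i. x i / s)"
    using s by (intro modular_mono assms) (auto simp: abs_divide intro!: divide_left_mono)
  then show ?thesis using s by simp
qed

lemma mo_spaceI: "r > 0 \<Longrightarrow> modular \<Phi> (\<lambda>i. x i / r) \<le> 1 \<Longrightarrow> x \<in> mo_space \<Phi>"
proof -
  assume r: "r > 0" "modular \<Phi> (\<lambda>i. x i / r) \<le> 1"
  then have "modular \<Phi> (\<lambda>i. (1 / r) * x i) < \<infinity>" "1 / r > 0"
    using le_less_trans[OF r(2), of \<infinity>] by simp_all
  then show ?thesis unfolding mo_space_def by blast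
qed

text \<open>For every scale \<open>r > B\<close> the condition "modular of \<open>u j / r\<close> at
  most 1" is closed under coordinatewise limits; then \<open>r\<close> decreases to
  \<open>B\<close>. This lower semicontinuity of the norm gives both compactness of balls and
  completeness.\<close>

lemma mo_norm_bounded_limit:
  fixes u :: "nat \<Rightarrow> nat \<Rightarrow> real"
  assumes "musielak_orlicz \<Phi>" "range u \<subseteq> mo_space \<Phi>" "\<And>i. (\<lambda>j. u j i) \<longlonglongrightarrow> x i"
    and "eventually (\<lambda>j. mo_norm \<Phi> (u j) \<le> B) sequentially"
  shows "x \<in> mo_space \<Phi>" "mo_norm \<Phi> x \<le> B"
proof -
  obtain j where "mo_norm \<Phi> (u j) \<le> B"
    using assms(4) by (auto simp: eventually_sequentially)
  moreover have "0 \<le> mo_norm \<Phi> (u j)"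
    using assms(1,2) by (auto intro: mo_norm_nonneg)
  ultimately have B: "B \<ge> 0" by simp
  have *: "modular \<Phi> (\<lambda>i. x i / r) \<le> 1" if "r > B" for r
  proof (rule modular_le_1_coordinatewise_limit[OF assms(1)])
    show "(\<lambda>j. u j i / r) \<longlonglongrightarrow> x i / r" for i
      using that B by (intro tendsto_divide assms) auto
    show "eventually (\<lambda>j. modular \<Phi> (\<lambda>i. u j i / r) \<le> 1) sequentially"
      using assms(4)
      by eventually_elim (use assms(1,2) that in \<open>auto intro!: modular_le_1_if_norm_less\<close>)
  qed
  show "x \<in> mo_space \<Phi>"
    using mo_spaceI[OF _ *[of "B + 1"]] B by simp
  have "mo_norm \<Phi> x \<le> B + e" if "e > 0" for e
    using that B by (intro mo_norm_le *) auto
  then show "mo_norm \<Phi> x \<le> B" by (rule field_le_epsilon)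
qed

text \<open>At a scale \<open>r\<close> above the norm the whole modular is at most 1, hence so is
  its \<open>i\<close>-th term, and non-degeneracy bounds the argument of that term.\<close>

lemma coordinate_bound:
  assumes "musielak_orlicz \<Phi>" "mo_nondegenerate \<Phi>"
  obtains T where "\<And>i. T i > 0" "\<And>x i. x \<in> mo_space \<Phi> \<Longrightarrow> \<bar>x i\<bar> \<le> T i * mo_norm \<Phi> x"
proof -
  have "\<forall>i. \<exists>T>0. \<forall>t. \<Phi> i t \<le> 1 \<longrightarrow> \<bar>t\<bar> \<le> T"
  proof
    fix i
    obtain T where "T > 0" "\<And>t. \<Phi> i t \<le> 1 \<Longrightarrow> \<bar>t\<bar> \<le> T"
      using assms orlicz_unbounded[of "\<Phi> i"] by (auto simp: musielak_orlicz_def mo_nondegenerate_def)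
    then show "\<exists>T>0. \<forall>t. \<Phi> i t \<le> 1 \<longrightarrow> \<bar>t\<bar> \<le> T" by blast
  qed
  then obtain T where T: "\<And>i. T i > 0" "\<And>i t. \<Phi> i t \<le> 1 \<Longrightarrow> \<bar>t\<bar> \<le> T i" by metis
  have "\<bar>x i\<bar> \<le> T i * mo_norm \<Phi> x" if x: "x \<in> mo_space \<Phi>" for x i
  proof (rule field_le_epsilon)
    fix e :: real assume e: "e > 0"
    \<comment> \<open>The slack is divided by \<open>T i\<close> so that it becomes \<open>e\<close>
      after multiplication by \<open>T i\<close>.\<close>
    define r where "r = mo_norm \<Phi> x + e / T i"
    have r: "mo_norm \<Phi> x < r" using e T(1)[of i] by (simp add: r_def)
    then have "r > 0" using mo_norm_nonneg[OF assms(1) x] by simp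
    have nn: "0 \<le> \<Phi> j (x j / r)" for j
      using assms(1) orlicz_nonneg by (simp add: musielak_orlicz_def)
    have "(\<Sum>j<Suc i. \<Phi> j (x j / r)) \<le> 1"
      using modular_le_1_if_norm_less[OF assms(1) x r]
      unfolding modular_le_1_iff[OF assms(1)] by blast
    then have "\<Phi> i (x i / r) \<le> 1"
      using sum_nonneg[of "{..<i}" "\<lambda>j. \<Phi> j (x j / r)"] nn by simp
    then have "\<bar>x i / r\<bar> \<le> T i" by (rule T(2))
    then have "\<bar>x i\<bar> \<le> T i * r" using \<open>r > 0\<close> by (simp add: abs_divide divide_le_eq)
    then show "\<bar>x i\<bar> \<le> T i * mo_norm \<Phi> x + e"
      using T(1)[of i] by (simp add: r_def distrib_left)
  qed
  then show ?thesis using that T(1) by blast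
qed

section \<open>Sequential compactness of balls and completeness\<close>

lemma mo_norm_minus_commute:
  assumes "musielak_orlicz \<Phi>"
  shows "mo_norm \<Phi> (\<lambda>i. x i - y i) = mo_norm \<Phi> (\<lambda>i. y i - x i)"
  using mo_norm_neg[OF assms, of "\<lambda>i. x i - y i"] by simp

lemma mo_norm_triangle_diff:
  assumes "musielak_orlicz \<Phi>" "x \<in> mo_space \<Phi>" "y \<in> mo_space \<Phi>" "z \<in> mo_space \<Phi>"
  shows "mo_norm \<Phi> (\<lambda>i. x i - z i) \<le> mo_norm \<Phi> (\<lambda>i. x i - y i) + mo_norm \<Phi> (\<lambda>i. y i - z i)"
  using mo_norm_triangle[OF assms(1) mo_space_diff[OF assms(1), of x y] mo_space_diff[OF assms(1), of y z]]
    assms by simp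

text \<open>By \<open>coordinate_bound\<close> a norm-bounded sequence lies in a box, and balls are
  closed under coordinatewise limits. This is the weak-star compactness of balls in sequential
  form.\<close>

lemma bounded_seq_coordinatewise_convergent:
  fixes u :: "nat \<Rightarrow> nat \<Rightarrow> real"
  assumes mo: "musielak_orlicz \<Phi>" "mo_nondegenerate \<Phi>"
    and u: "range u \<subseteq> mo_space \<Phi>" "\<And>j. mo_norm \<Phi> (u j) \<le> B"
  obtains x r where "strict_mono r" "x \<in> mo_space \<Phi>" "mo_norm \<Phi> x \<le> B"
    "\<And>i. (\<lambda>j. u (r j) i) \<longlonglongrightarrow> x i"
proof -
  obtain T where T: "\<And>i. T i > 0" "\<And>x i. x \<in> mo_space \<Phi> \<Longrightarrow> \<bar>x i\<bar> \<le> T i * mo_norm \<Phi> x"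
    using coordinate_bound[OF mo] by blast
  have "\<bar>u j i\<bar> \<le> T i * B" for i j
  proof -
    have "\<bar>u j i\<bar> \<le> T i * mo_norm \<Phi> (u j)" using u(1) by (intro T(2)) auto
    also have "\<dots> \<le> T i * B" using u(2) T(1)[of i] by (intro mult_left_mono) auto
    finally show ?thesis .
  qed
  then obtain x r where r: "strict_mono r" "\<And>i. (\<lambda>j. u (r j) i) \<longlonglongrightarrow> x i"
    using bounded_coordinatewise_convergent_subseq[of u "\<lambda>i. T i * B"] by blast
  have "x \<in> mo_space \<Phi>" "mo_norm \<Phi> x \<le> B"
    using mo_norm_bounded_limit[of \<Phi> "\<lambda>j. u (r j)" x B] mo(1) r(2) u by auto
  then show ?thesis using that r by blast
qed

lemma mo_space_complete:
  fixes u :: "nat \<Rightarrow> nat \<Rightarrow> real"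
  assumes mo: "musielak_orlicz \<Phi>" "mo_nondegenerate \<Phi>"
    and u: "range u \<subseteq> mo_space \<Phi>"
    and cauchy: "\<And>e. e > 0 \<Longrightarrow> \<exists>N. \<forall>j\<ge>N. \<forall>k\<ge>N. mo_norm \<Phi> (\<lambda>i. u j i - u k i) \<le> e"
  obtains x where "x \<in> mo_space \<Phi>" "(\<lambda>j. mo_norm \<Phi> (\<lambda>i. u j i - x i)) \<longlonglongrightarrow> 0"
proof -
  obtain T where T: "\<And>i. T i > 0" "\<And>x i. x \<in> mo_space \<Phi> \<Longrightarrow> \<bar>x i\<bar> \<le> T i * mo_norm \<Phi> x"
    using coordinate_bound[OF mo] by blast
  have diff: "(\<lambda>i. u j i - u k i) \<in> mo_space \<Phi>" for j k
    using u by (intro mo_space_diff mo) auto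
  have "Cauchy (\<lambda>j. u j i)" for i
  proof (rule CauchyI)
    fix e :: real assume "e > 0"
    then obtain N where N: "\<forall>j\<ge>N. \<forall>k\<ge>N. mo_norm \<Phi> (\<lambda>i. u j i - u k i) \<le> e / (2 * T i)"
      using cauchy[of "e / (2 * T i)"] T(1)[of i] by auto
    have "norm (u j i - u k i) < e" if "j \<ge> N" "k \<ge> N" for j k
    proof -
      have "\<bar>u j i - u k i\<bar> \<le> T i * mo_norm \<Phi> (\<lambda>i. u j i - u k i)"
        using T(2)[OF diff] .
      also have "\<dots> \<le> T i * (e / (2 * T i))"
        using N that T(1)[of i] by (intro mult_left_mono) auto
      also have "\<dots> < e" using T(1)[of i] \<open>e > 0\<close> by (simp add: field_simps)
      finally show ?thesis by simp
    qed
    then show "\<exists>N. \<forall>j\<ge>N. \<forall>k\<ge>N. norm (u j i - u k i) < e" by blast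
  qed
  then obtain x where x: "\<And>i. (\<lambda>j. u j i) \<longlonglongrightarrow> x i"
    unfolding Cauchy_convergent_iff convergent_def by metis
  \<comment> \<open>With \<open>j\<close> fixed, \<open>u j - u k\<close> converges coordinatewise
    to \<open>u j - x\<close> as \<open>k\<close> grows, so lower semicontinuity of the norm passes
    the Cauchy estimate to the limit.\<close>
  have lim: "(\<lambda>i. u j i - x i) \<in> mo_space \<Phi> \<and> mo_norm \<Phi> (\<lambda>i. u j i - x i) \<le> e"
    if "\<forall>k\<ge>N. mo_norm \<Phi> (\<lambda>i. u j i - u k i) \<le> e" for N j e
  proof -
    have "range (\<lambda>k i. u j i - u k i) \<subseteq> mo_space \<Phi>" using diff by blast
    moreover have "(\<lambda>k. u j i - u k i) \<longlonglongrightarrow> u j i - x i" for i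
      by (intro tendsto_diff tendsto_const x)
    moreover have "eventually (\<lambda>k. mo_norm \<Phi> (\<lambda>i. u j i - u k i) \<le> e) sequentially"
      using that by (auto simp: eventually_sequentially)
    ultimately show ?thesis
      using mo_norm_bounded_limit[OF mo(1), of "\<lambda>k i. u j i - u k i" "\<lambda>i. u j i - x i" e] by blast
  qed
  obtain N where "\<forall>j\<ge>N. \<forall>k\<ge>N. mo_norm \<Phi> (\<lambda>i. u j i - u k i) \<le> 1" using cauchy[of 1] by auto
  then have "(\<lambda>i. u N i - x i) \<in> mo_space \<Phi>" using lim[of N N 1] by blast
  \<comment> \<open>\<open>x\<close> is the difference of \<open>u N\<close> and
    \<open>u N - x\<close>, both in the space.\<close>
  then have xm: "x \<in> mo_space \<Phi>"
    using mo_space_diff[OF mo(1), of "u N" "\<lambda>i. u N i - x i"] u by auto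
  have "(\<lambda>j. mo_norm \<Phi> (\<lambda>i. u j i - x i)) \<longlonglongrightarrow> 0"
  proof (rule LIMSEQ_I)
    fix e :: real assume e: "e > 0"
    obtain N where N: "\<forall>j\<ge>N. \<forall>k\<ge>N. mo_norm \<Phi> (\<lambda>i. u j i - u k i) \<le> e / 2"
      using cauchy[of "e / 2"] e by auto
    have "norm (mo_norm \<Phi> (\<lambda>i. u j i - x i) - 0) < e" if "j \<ge> N" for j
      using lim[of N j "e / 2"] N that mo_norm_nonneg[OF mo(1), of "\<lambda>i. u j i - x i"] e by auto
    then show "\<exists>N. \<forall>j\<ge>N. norm (mo_norm \<Phi> (\<lambda>i. u j i - x i) - 0) < e" by blast
  qed
  then show ?thesis using that xm by blast
qed

section \<open>Density of finitely supported sequences\<close>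

lemma finite_support_in_mo_space:
  assumes "musielak_orlicz \<Phi>" "\<And>i. i \<ge> n \<Longrightarrow> x i = 0"
  shows "x \<in> mo_space \<Phi>"
proof -
  have "modular \<Phi> (\<lambda>i. 1 * x i) < \<infinity>"
    using modular_finite_support[OF assms] by simp
  then show ?thesis
    unfolding mo_space_def using zero_less_one by blast
qed

lemma mo_norm_scale_le:
  assumes mo: "musielak_orlicz \<Phi>" and x: "x \<in> mo_space \<Phi>"
  shows "mo_norm \<Phi> (\<lambda>i. c * x i) \<le> \<bar>c\<bar> * mo_norm \<Phi> x"
proof (cases "c = 0")
  case True
  then show ?thesis using mo_norm_zero[OF mo] by simp
next
  case False
  show ?thesis
  proof (rule field_le_epsilon)
    fix e :: real assume "e > 0"
    define r where "r = mo_norm \<Phi> x + e / \<bar>c\<bar>"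
    have r: "mo_norm \<Phi> x < r" using \<open>e > 0\<close> False by (simp add: r_def)
    then have "r > 0" using mo_norm_nonneg[OF mo x] by simp
    have "modular \<Phi> (\<lambda>i. c * x i / (\<bar>c\<bar> * r)) \<le> modular \<Phi> (\<lambda>i. x i / r)"
      using \<open>r > 0\<close> False by (intro modular_mono mo) (simp add: abs_mult)
    also have "\<dots> \<le> 1" by (rule modular_le_1_if_norm_less[OF mo x r])
    finally have "mo_norm \<Phi> (\<lambda>i. c * x i) \<le> \<bar>c\<bar> * r"
      using \<open>r > 0\<close> False by (intro mo_norm_le) auto
    then show "mo_norm \<Phi> (\<lambda>i. c * x i) \<le> \<bar>c\<bar> * mo_norm \<Phi> x + e"
      using False by (simp add: r_def distrib_left)
  qed
qed

text \<open>Indexing by lists of rationals makes the family of approximating points visibly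
  countable, as Baire's theorem requires.\<close>

definition rat_seq :: "rat list \<Rightarrow> nat \<Rightarrow> real" where
  "rat_seq l i = (if i < length l then of_rat (l ! i) else 0)"

lemma rat_seq_in_mo_space: "musielak_orlicz \<Phi> \<Longrightarrow> rat_seq l \<in> mo_space \<Phi>"
  by (rule finite_support_in_mo_space[of _ "length l"]) (simp_all add: rat_seq_def)

lemma rat_seq_approx_finite_support:
  assumes mo: "musielak_orlicz \<Phi>" and x: "\<And>i. i \<ge> n \<Longrightarrow> x i = 0" and e: "e > 0"
  obtains l where "mo_norm \<Phi> (\<lambda>i. x i - rat_seq l i) \<le> e"
proof -
  \<comment> \<open>Each of the \<open>n\<close> relevant coordinates may contribute
    \<open>1 / (real n + 1)\<close>, which keeps the modular at most 1. Continuity of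
    \<open>\<Phi> i\<close> at 0 and density of the rationals provide the coordinate.\<close>
  have "\<forall>i. \<exists>q. \<Phi> i ((x i - of_rat q) / e) \<le> 1 / (real n + 1)"
  proof
    fix i
    have "orlicz (\<Phi> i)" using mo by (simp add: musielak_orlicz_def)
    then obtain d where d: "d > 0" "\<And>t. \<bar>t\<bar> < d \<Longrightarrow> \<Phi> i t \<le> 1 / (real n + 1)"
      by (rule orlicz_small_near_0[of _ "1 / (real n + 1)"]) auto
    obtain q where q: "x i < of_rat q" "of_rat q < x i + d * e"
      using of_rat_dense[of "x i" "x i + d * e"] d(1) e by auto
    have "\<bar>(x i - of_rat q) / e\<bar> < d"
      using q e by (simp add: abs_divide divide_less_eq abs_less_iff)
    then show "\<exists>q. \<Phi> i ((x i - of_rat q) / e) \<le> 1 / (real n + 1)" using d(2) by blast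
  qed
  then obtain q where q: "\<And>i. \<Phi> i ((x i - of_rat (q i)) / e) \<le> 1 / (real n + 1)" by metis
  define l where "l = map q [0..<n]"
  have "modular \<Phi> (\<lambda>i. (x i - rat_seq l i) / e)
      = ennreal (\<Sum>i<n. \<Phi> i ((x i - rat_seq l i) / e))"
    by (rule modular_finite_support[OF mo]) (simp add: x l_def rat_seq_def)
  also have "(\<Sum>i<n. \<Phi> i ((x i - rat_seq l i) / e)) \<le> (\<Sum>i<n. 1 / (real n + 1))"
    using q by (intro sum_mono) (simp add: l_def rat_seq_def)
  also have "\<dots> \<le> 1" by simp
  finally have "modular \<Phi> (\<lambda>i. (x i - rat_seq l i) / e) \<le> 1"
    by (simp add: ennreal_leI)
  then show ?thesis by (intro that mo_norm_le e)
qed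

text \<open>As \<open>mo_h \<Phi>\<close> is an intersection of closed subspaces, it suffices that
  the closure \<open>V\<close> of the finitely supported sequences is one of those intersected. The
  sequences with finite modular at every scale lie in \<open>V\<close> because their truncations
  converge in norm.\<close>

lemma mo_h_finite_support_approx:
  assumes mo: "musielak_orlicz \<Phi>" "mo_nondegenerate \<Phi>" and x: "x \<in> mo_h \<Phi>" and e: "e > 0"
  obtains y n where "\<And>i. i \<ge> n \<Longrightarrow> y i = 0" "mo_norm \<Phi> (\<lambda>i. x i - y i) < e"
proof -
  interpret M: Metric_space "mo_space \<Phi>" "mo_dist \<Phi>" by (rule mo_metric[OF mo])
  define F where "F = {y :: nat \<Rightarrow> real. \<exists>n. \<forall>i\<ge>n. y i = 0}"
  define V where "V = mo_top \<Phi> closure_of F"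
  have F: "F \<subseteq> mo_space \<Phi>"
    using finite_support_in_mo_space[OF mo(1)] by (auto simp: F_def)
  have V: "z \<in> V \<longleftrightarrow> z \<in> mo_space \<Phi> \<and> (\<forall>r>0. \<exists>y\<in>F. mo_norm \<Phi> (\<lambda>i. z i - y i) < r)" for z
    using F unfolding V_def mo_top_def M.metric_closure_of
    by (fastforce simp: mo_dist_def subset_iff)
  have "seq_subspace V"
    unfolding seq_subspace_def
  proof (intro conjI ballI allI)
    have "(\<lambda>i. 0) \<in> F" by (simp add: F_def)
    then show "(\<lambda>i. 0) \<in> V"
      using mo_norm_zero[OF mo(1)] mo_space_zero[OF mo(1)]
      by (auto simp: V intro!: bexI[of _ "\<lambda>i. 0"])
    show "(\<lambda>i. a i + b i) \<in> V" if ab: "a \<in> V" "b \<in> V" for a b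
      unfolding V
    proof (intro conjI allI impI)
      show "(\<lambda>i. a i + b i) \<in> mo_space \<Phi>" using ab by (intro mo_space_add mo) (auto simp: V)
      fix r :: real assume "r > 0"
      then obtain y z where y: "y \<in> F" "mo_norm \<Phi> (\<lambda>i. a i - y i) < r / 2"
        and z: "z \<in> F" "mo_norm \<Phi> (\<lambda>i. b i - z i) < r / 2"
        using ab half_gt_zero[of r] unfolding V by meson
      obtain n m where "\<forall>i\<ge>n. y i = 0" "\<forall>i\<ge>m. z i = 0" using y z by (auto simp: F_def)
      then have "(\<lambda>i. y i + z i) \<in> F" by (auto simp: F_def intro!: exI[of _ "max n m"])
      moreover have "mo_norm \<Phi> (\<lambda>i. (a i - y i) + (b i - z i))
          \<le> mo_norm \<Phi> (\<lambda>i. a i - y i) + mo_norm \<Phi> (\<lambda>i. b i - z i)"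
        using ab y z F by (intro mo_norm_triangle mo_space_diff mo) (auto simp: V)
      then have "mo_norm \<Phi> (\<lambda>i. (a i + b i) - (y i + z i)) < r"
        using y z by (simp add: algebra_simps)
      ultimately show "\<exists>y\<in>F. mo_norm \<Phi> (\<lambda>i. a i + b i - y i) < r"
        by (intro bexI[of _ "\<lambda>i. y i + z i"])
    qed
    show "(\<lambda>i. c * a i) \<in> V" if a: "a \<in> V" for c a
      unfolding V
    proof (intro conjI allI impI)
      show "(\<lambda>i. c * a i) \<in> mo_space \<Phi>" using a by (intro mo_space_scale mo) (auto simp: V)
      fix r :: real assume "r > 0"
      \<comment> \<open>The summand 1 keeps the denominator positive when
        \<open>c = 0\<close>.\<close>
      then obtain y where y: "y \<in> F" "mo_norm \<Phi> (\<lambda>i. a i - y i) < r / (\<bar>c\<bar> + 1)"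
        using a divide_pos_pos[of r "\<bar>c\<bar> + 1"] unfolding V by fastforce
      have cy: "(\<lambda>i. c * y i) \<in> F" using y(1) by (auto simp: F_def)
      have d: "(\<lambda>i. a i - y i) \<in> mo_space \<Phi>"
        using a y F by (intro mo_space_diff mo) (auto simp: V)
      then have "mo_norm \<Phi> (\<lambda>i. c * (a i - y i)) \<le> \<bar>c\<bar> * mo_norm \<Phi> (\<lambda>i. a i - y i)"
        by (rule mo_norm_scale_le[OF mo(1)])
      moreover have "mo_norm \<Phi> (\<lambda>i. a i - y i) * (\<bar>c\<bar> + 1) < r"
        using y(2) by (subst (asm) pos_less_divide_eq) auto
      ultimately have "mo_norm \<Phi> (\<lambda>i. c * a i - c * y i) < r"
        using mo_norm_nonneg[OF mo(1) d] by (simp add: algebra_simps)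
      then show "\<exists>y\<in>F. mo_norm \<Phi> (\<lambda>i. c * a i - y i) < r"
        using cy by (intro bexI[of _ "\<lambda>i. c * y i"])
    qed
  qed
  moreover have "closedin (mo_top \<Phi>) V" by (simp add: V_def)
  moreover have "{x \<in> mo_space \<Phi>. \<forall>c>0. modular \<Phi> (\<lambda>i. c * x i) < \<infinity>} \<subseteq> V"
  proof
    fix z assume z: "z \<in> {x \<in> mo_space \<Phi>. \<forall>c>0. modular \<Phi> (\<lambda>i. c * x i) < \<infinity>}"
    have "\<exists>y\<in>F. mo_norm \<Phi> (\<lambda>i. z i - y i) < r" if "r > 0" for r
    proof -
      \<comment> \<open>The norm will be tested at scale \<open>r / 2\<close>, half of
        \<open>r\<close> to get a strict inequality; dividing by it is multiplying by
        \<open>c\<close>.\<close>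
      define c where "c = 2 / r"
      have c: "c > 0" using that by (simp add: c_def)
      have nn: "0 \<le> \<Phi> i t" "\<Phi> i 0 = 0" for i t
        using mo(1) orlicz_nonneg by (simp_all add: musielak_orlicz_def orlicz_def)
      have "modular \<Phi> (\<lambda>i. c * z i) \<noteq> top" using z c by auto
      then have sm: "summable (\<lambda>i. \<Phi> i (c * z i))"
        unfolding modular_def using nn by (intro summable_suminf_not_top) auto
      then obtain n where n: "norm (\<Sum>i. \<Phi> (i + n) (c * z (i + n))) < 1"
        using suminf_exist_split[of 1 "\<lambda>i. \<Phi> i (c * z i)"] by auto
      \<comment> \<open>The truncation at \<open>n\<close>: what remains of \<open>z\<close> has
        modular, at scale \<open>r / 2\<close>, equal to the tail of the series from
        \<open>n\<close> on, which is below 1.\<close>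
      define y where "y i = (if i < n then z i else 0)" for i
      have "y \<in> F" by (auto simp: F_def y_def intro!: exI[of _ n])
      moreover have "modular \<Phi> (\<lambda>i. (z i - y i) / (r / 2)) \<le> 1"
        unfolding modular_le_1_iff[OF mo(1)]
      proof
        fix m
        have "(\<Sum>i<m. \<Phi> i ((z i - y i) / (r / 2))) \<le> (\<Sum>i<m + n. \<Phi> i ((z i - y i) / (r / 2)))"
          using nn by (intro sum_mono2) auto
        also have "\<dots> = (\<Sum>i\<in>{n..<m + n}. \<Phi> i (c * z i))"
          using nn(2) by (intro sum.mono_neutral_cong_right) (auto simp: y_def c_def mult.commute)
        also have "\<dots> = (\<Sum>i<m. \<Phi> (i + n) (c * z (i + n)))"
          using sum.shift_bounds_nat_ivl[of "\<lambda>i. \<Phi> i (c * z i)" 0 n m]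
          by (simp add: atLeast0LessThan)
        also have "\<dots> \<le> (\<Sum>i. \<Phi> (i + n) (c * z (i + n)))"
          using nn sm by (intro sum_le_suminf summable_ignore_initial_segment[of "\<lambda>i. \<Phi> i (c * z i)"]) auto
        also have "\<dots> \<le> 1" using n by simp
        finally show "(\<Sum>i<m. \<Phi> i ((z i - y i) / (r / 2))) \<le> 1" .
      qed
      then have "mo_norm \<Phi> (\<lambda>i. z i - y i) \<le> r / 2" using that by (intro mo_norm_le) auto
      then have "mo_norm \<Phi> (\<lambda>i. z i - y i) < r" using that by simp
      ultimately show ?thesis by blast
    qed
    then show "z \<in> V" using z by (simp add: V)
  qed
  ultimately have "x \<in> V" using x unfolding mo_h_def by blast
  then obtain y where "y \<in> F" "mo_norm \<Phi> (\<lambda>i. x i - y i) < e" using e unfolding V by blast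
  then show ?thesis using that by (auto simp: F_def)
qed

text \<open>Separability of the space. The hypothesis that \<open>mo_h \<Phi>\<close> is everything
  enters here: it makes finitely supported sequences, and then rational ones, dense.\<close>

lemma mo_h_rat_seq_approx:
  assumes mo: "musielak_orlicz \<Phi>" "mo_nondegenerate \<Phi>" "mo_h \<Phi> = mo_space \<Phi>"
    and x: "x \<in> mo_space \<Phi>" and e: "e > 0"
  obtains l where "mo_norm \<Phi> (\<lambda>i. x i - rat_seq l i) < e"
proof -
  obtain y n where y: "\<And>i. i \<ge> n \<Longrightarrow> y i = 0" "mo_norm \<Phi> (\<lambda>i. x i - y i) < e / 2"
    using mo_h_finite_support_approx[OF mo(1,2), of x "e / 2"] x e mo(3) half_gt_zero[OF e] by metis
  obtain l where l: "mo_norm \<Phi> (\<lambda>i. y i - rat_seq l i) \<le> e / 2"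
    by (rule rat_seq_approx_finite_support[of \<Phi> n y "e / 2"]) (use mo(1) y(1) e in auto)
  have "mo_norm \<Phi> (\<lambda>i. x i - rat_seq l i)
      \<le> mo_norm \<Phi> (\<lambda>i. x i - y i) + mo_norm \<Phi> (\<lambda>i. y i - rat_seq l i)"
    using finite_support_in_mo_space[OF mo(1) y(1)]
    by (intro mo_norm_triangle_diff mo x rat_seq_in_mo_space) auto
  then have "mo_norm \<Phi> (\<lambda>i. x i - rat_seq l i) < e" using y(2) l by linarith
  then show ?thesis by (rule that)
qed

section \<open>The dual and the predual\<close>

lemma mo_dual_add: "\<phi> \<in> mo_dual \<Phi> \<Longrightarrow> x \<in> mo_space \<Phi> \<Longrightarrow> y \<in> mo_space \<Phi> \<Longrightarrow>
    \<phi> (\<lambda>i. x i + y i) = \<phi> x + \<phi> y"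
  by (simp add: mo_dual_def)

lemma mo_dual_scale: "\<phi> \<in> mo_dual \<Phi> \<Longrightarrow> x \<in> mo_space \<Phi> \<Longrightarrow> \<phi> (\<lambda>i. c * x i) = c * \<phi> x"
  by (simp add: mo_dual_def)

lemma mo_dual_diff:
  assumes "musielak_orlicz \<Phi>" "\<phi> \<in> mo_dual \<Phi>" "x \<in> mo_space \<Phi>" "y \<in> mo_space \<Phi>"
  shows "\<phi> (\<lambda>i. x i - y i) = \<phi> x - \<phi> y"
  using mo_dual_add[OF assms(2,3) mo_space_scale[OF assms(1,4), of "-1"]]
    mo_dual_scale[OF assms(2,4), of "-1"] by simp

text \<open>\<open>x / r\<close> is in the unit ball for every \<open>r\<close> above the norm of
  \<open>x\<close>; letting \<open>r\<close> decrease to the norm also covers the case of norm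
  zero.\<close>

lemma dual_dist_apply:
  assumes mo: "musielak_orlicz \<Phi>" and f: "\<phi> \<in> mo_dual \<Phi>" "\<psi> \<in> mo_dual \<Phi>" and x: "x \<in> mo_space \<Phi>"
  shows "\<bar>\<phi> x - \<psi> x\<bar> \<le> dual_dist \<Phi> \<phi> \<psi> * mo_norm \<Phi> x"
proof -
  let ?d = "dual_dist \<Phi> \<phi> \<psi>"
  have d: "?d \<ge> 0" by (rule Metric_space.nonneg[OF dual_metric[OF mo]])
  have *: "\<bar>\<phi> x - \<psi> x\<bar> \<le> ?d * r" if r: "mo_norm \<Phi> x < r" for r
  proof -
    have "r > 0" using r mo_norm_nonneg[OF mo x] by simp
    have "mo_norm \<Phi> (\<lambda>i. (1 / r) * x i) \<le> 1"
      using mo_norm_le[of 1 \<Phi> "\<lambda>i. x i / r"] modular_le_1_if_norm_less[OF mo x r] by simp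
    then have "\<bar>\<phi> (\<lambda>i. (1 / r) * x i) - \<psi> (\<lambda>i. (1 / r) * x i)\<bar> \<le> ?d"
      unfolding dual_dist_def dual_norm_def using f mo_space_scale[OF mo x, of "1 / r"]
      by (auto intro!: cSUP_upper dual_bdd[OF mo])
    then have "\<bar>(1 / r) * (\<phi> x - \<psi> x)\<bar> \<le> ?d"
      unfolding mo_dual_scale[OF f(1) x] mo_dual_scale[OF f(2) x] by (simp only: right_diff_distrib)
    then show ?thesis using \<open>r > 0\<close> by (simp add: abs_mult divide_le_eq)
  qed
  show ?thesis
  proof (rule field_le_epsilon)
    fix e :: real assume "e > 0"
    \<comment> \<open>Dividing by \<open>?d + 1\<close> instead of \<open>?d\<close> allows
      \<open>?d = 0\<close>.\<close>
    have "\<bar>\<phi> x - \<psi> x\<bar> \<le> ?d * (mo_norm \<Phi> x + e / (?d + 1))"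
      using \<open>e > 0\<close> d by (intro *) auto
    also have "\<dots> \<le> ?d * mo_norm \<Phi> x + e"
      using \<open>e > 0\<close> d by (simp add: distrib_left divide_le_eq)
    finally show "\<bar>\<phi> x - \<psi> x\<bar> \<le> ?d * mo_norm \<Phi> x + e" .
  qed
qed

lemma dual_dist_le:
  assumes mo: "musielak_orlicz \<Phi>" and f: "\<phi> \<in> mo_dual \<Phi>" "\<psi> \<in> mo_dual \<Phi>"
    and K: "0 \<le> K" "\<And>x. x \<in> mo_space \<Phi> \<Longrightarrow> \<bar>\<phi> x - \<psi> x\<bar> \<le> K * mo_norm \<Phi> x"
  shows "dual_dist \<Phi> \<phi> \<psi> \<le> K"
proof -
  \<comment> \<open>The unit ball is nonempty, so bounding every value bounds the real
    supremum.\<close>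
  have "(\<lambda>i. 0) \<in> {x \<in> mo_space \<Phi>. mo_norm \<Phi> x \<le> 1}"
    using mo_space_zero[OF mo] mo_norm_zero[OF mo] by simp
  moreover have "\<bar>\<phi> x - \<psi> x\<bar> \<le> K" if x: "x \<in> mo_space \<Phi>" "mo_norm \<Phi> x \<le> 1" for x
    using K(2)[OF x(1)] mult_left_mono[OF x(2) K(1)] by simp
  ultimately show ?thesis
    using f unfolding dual_dist_def dual_norm_def by (auto intro!: cSUP_least)
qed

lemma mo_dualI:
  assumes mo: "musielak_orlicz \<Phi>"
    and "\<And>x y. x \<in> mo_space \<Phi> \<Longrightarrow> y \<in> mo_space \<Phi> \<Longrightarrow> g (\<lambda>i. x i + y i) = g x + g y"
    and "\<And>c x. x \<in> mo_space \<Phi> \<Longrightarrow> g (\<lambda>i. c * x i) = c * g x"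
    and "\<And>x. x \<in> mo_space \<Phi> \<Longrightarrow> \<bar>g x\<bar> \<le> C * mo_norm \<Phi> x"
  shows "restrict g (mo_space \<Phi>) \<in> mo_dual \<Phi>"
  using assms by (auto simp: mo_dual_def mo_space_add mo_space_scale intro!: exI[of _ C])

text \<open>The restriction to the space keeps the combination extensional, as membership in
  \<open>mo_dual \<Phi>\<close> demands.\<close>

definition lin_comb ::
    "(nat \<Rightarrow> real \<Rightarrow> real) \<Rightarrow> ((nat \<Rightarrow> real) \<Rightarrow> real) \<Rightarrow> real \<Rightarrow> ((nat \<Rightarrow> real) \<Rightarrow> real) \<Rightarrow> (nat \<Rightarrow> real) \<Rightarrow> real" where
  "lin_comb \<Phi> \<phi> c \<psi> = (\<lambda>x\<in>mo_space \<Phi>. \<phi> x + c * \<psi> x)"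

lemma lin_comb_apply: "x \<in> mo_space \<Phi> \<Longrightarrow> lin_comb \<Phi> \<phi> c \<psi> x = \<phi> x + c * \<psi> x"
  by (simp add: lin_comb_def)

lemma lin_comb_in_mo_dual:
  assumes mo: "musielak_orlicz \<Phi>" and f: "\<phi> \<in> mo_dual \<Phi>" "\<psi> \<in> mo_dual \<Phi>"
  shows "lin_comb \<Phi> \<phi> c \<psi> \<in> mo_dual \<Phi>"
proof -
  obtain C D where C: "\<forall>x\<in>mo_space \<Phi>. \<bar>\<phi> x\<bar> \<le> C * mo_norm \<Phi> x"
    and D: "\<forall>x\<in>mo_space \<Phi>. \<bar>\<psi> x\<bar> \<le> D * mo_norm \<Phi> x"
    using f by (auto simp: mo_dual_def)
  show ?thesis
    unfolding lin_comb_def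
  proof (rule mo_dualI[OF mo, where C = "C + \<bar>c\<bar> * D"])
    fix x assume x: "x \<in> mo_space \<Phi>"
    have "\<bar>\<phi> x + c * \<psi> x\<bar> \<le> \<bar>\<phi> x\<bar> + \<bar>c\<bar> * \<bar>\<psi> x\<bar>"
      by (metis abs_mult abs_triangle_ineq)
    also have "\<dots> \<le> C * mo_norm \<Phi> x + \<bar>c\<bar> * (D * mo_norm \<Phi> x)"
      using C D x by (intro add_mono mult_left_mono) auto
    finally show "\<bar>\<phi> x + c * \<psi> x\<bar> \<le> (C + \<bar>c\<bar> * D) * mo_norm \<Phi> x"
      by (simp add: distrib_right)
  qed (use f in \<open>simp_all add: mo_dual_add mo_dual_scale algebra_simps\<close>)
qed

lemma mo_dual_zero: "musielak_orlicz \<Phi> \<Longrightarrow> (\<lambda>x\<in>mo_space \<Phi>. 0) \<in> mo_dual \<Phi>"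
  by (rule mo_dualI[where C = 0]) auto

text \<open>The space \<open>Y\<close> of the introductory comment. Boundedness of the sequences
  matches the compactness available: bounded sequences have coordinatewise convergent
  subsequences.\<close>

definition predual :: "(nat \<Rightarrow> real \<Rightarrow> real) \<Rightarrow> ((nat \<Rightarrow> real) \<Rightarrow> real) set" where
  "predual \<Phi> = {\<psi> \<in> mo_dual \<Phi>. \<forall>u x B. range u \<subseteq> mo_space \<Phi> \<and> (\<forall>j. mo_norm \<Phi> (u j) \<le> B)
     \<and> x \<in> mo_space \<Phi> \<and> (\<forall>i. (\<lambda>j. u j i) \<longlonglongrightarrow> x i) \<longrightarrow> (\<lambda>j. \<psi> (u j)) \<longlonglongrightarrow> \<psi> x}"

lemma predual_tendsto:
  fixes u :: "nat \<Rightarrow> nat \<Rightarrow> real"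
  assumes "\<psi> \<in> predual \<Phi>" "range u \<subseteq> mo_space \<Phi>" "\<And>j. mo_norm \<Phi> (u j) \<le> B"
    "x \<in> mo_space \<Phi>" "\<And>i. (\<lambda>j. u j i) \<longlonglongrightarrow> x i"
  shows "(\<lambda>j. \<psi> (u j)) \<longlonglongrightarrow> \<psi> x"
  using assms unfolding predual_def by blast

lemma predual_subset: "predual \<Phi> \<subseteq> mo_dual \<Phi>"
  by (auto simp: predual_def)

lemma predual_zero: "musielak_orlicz \<Phi> \<Longrightarrow> (\<lambda>x\<in>mo_space \<Phi>. 0) \<in> predual \<Phi>"
  by (auto simp: predual_def mo_dual_zero image_subset_iff)

lemma lin_comb_in_predual:
  assumes mo: "musielak_orlicz \<Phi>" and f: "\<phi> \<in> predual \<Phi>" "\<psi> \<in> predual \<Phi>"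
  shows "lin_comb \<Phi> \<phi> c \<psi> \<in> predual \<Phi>"
  unfolding predual_def
proof (intro CollectI conjI allI impI; (elim conjE)?)
  show "lin_comb \<Phi> \<phi> c \<psi> \<in> mo_dual \<Phi>"
    using f predual_subset by (intro lin_comb_in_mo_dual[OF mo]) auto
  fix u :: "nat \<Rightarrow> nat \<Rightarrow> real" and x B
  assume u: "range u \<subseteq> mo_space \<Phi>" "\<forall>j. mo_norm \<Phi> (u j) \<le> B" "x \<in> mo_space \<Phi>"
    "\<forall>i. (\<lambda>j. u j i) \<longlonglongrightarrow> x i"
  have "(\<lambda>j. \<phi> (u j) + c * \<psi> (u j)) \<longlonglongrightarrow> \<phi> x + c * \<psi> x"
    using u f by (intro tendsto_add tendsto_mult tendsto_const) (auto intro: predual_tendsto)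
  moreover have "u j \<in> mo_space \<Phi>" for j using u by auto
  ultimately show "(\<lambda>j. lin_comb \<Phi> \<phi> c \<psi> (u j)) \<longlonglongrightarrow> lin_comb \<Phi> \<phi> c \<psi> x"
    using u(3) by (simp add: lin_comb_apply)
qed

lemma finite_functional_in_predual:
  assumes mo: "musielak_orlicz \<Phi>"
    and C: "\<And>x. x \<in> mo_space \<Phi> \<Longrightarrow> \<bar>\<Sum>i<n. s i * x i\<bar> \<le> C * mo_norm \<Phi> x"
  shows "(\<lambda>x\<in>mo_space \<Phi>. \<Sum>i<n. s i * x i) \<in> predual \<Phi>"
  unfolding predual_def
proof (intro CollectI conjI allI impI; (elim conjE)?)
  show "(\<lambda>x\<in>mo_space \<Phi>. \<Sum>i<n. s i * x i) \<in> mo_dual \<Phi>"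
    by (rule mo_dualI[OF mo _ _ C]) (simp_all add: sum_distrib_left sum.distrib algebra_simps)
  fix u :: "nat \<Rightarrow> nat \<Rightarrow> real" and x B
  assume u: "range u \<subseteq> mo_space \<Phi>" "x \<in> mo_space \<Phi>" "\<forall>i. (\<lambda>j. u j i) \<longlonglongrightarrow> x i"
  have "(\<lambda>j. \<Sum>i<n. s i * u j i) \<longlonglongrightarrow> (\<Sum>i<n. s i * x i)"
    using u(3) by (intro tendsto_sum tendsto_mult tendsto_const) auto
  moreover have "u j \<in> mo_space \<Phi>" for j using u by auto
  ultimately show "(\<lambda>j. (\<lambda>x\<in>mo_space \<Phi>. \<Sum>i<n. s i * x i) (u j))
      \<longlonglongrightarrow> (\<lambda>x\<in>mo_space \<Phi>. \<Sum>i<n. s i * x i) x"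
    using u(2) by simp
qed

text \<open>The functional is made of subgradients of the \<^term>\<open>\<Phi> i\<close> at the coordinates of \<^term>\<open>x\<close>
  scaled to norm just above one, so its supremum over the unit ball is at most its value there.\<close>

lemma predual_norming:
  assumes mo: "musielak_orlicz \<Phi>" and x: "x \<in> mo_space \<Phi>" and r: "0 < r" "r < mo_norm \<Phi> x"
  obtains \<psi> where "\<psi> \<in> predual \<Phi>" "\<And>z. z \<in> mo_space \<Phi> \<Longrightarrow> \<bar>\<psi> z\<bar> \<le> mo_norm \<Phi> z" "\<psi> x = r"
proof -
  define u where "u i = x i / r" for i
  have o: "orlicz (\<Phi> i)" for i using mo by (simp add: musielak_orlicz_def)
  \<comment> \<open>If the modular of \<open>x / r\<close> were at most 1, the norm of
    \<open>x\<close> would be at most \<open>r\<close>. Already a finite partial sum exceeds 1, so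
    finitely many coordinates suffice for the functional.\<close>
  have "\<not> modular \<Phi> u \<le> 1" using mo_norm_le[OF r(1), of \<Phi> x] r(2) unfolding u_def by linarith
  then obtain n where n: "1 < (\<Sum>i<n. \<Phi> i (u i))"
    unfolding modular_le_1_iff[OF mo] by (auto simp: not_le)
  have "\<forall>i. \<exists>s. \<forall>t. \<Phi> i (u i) + s * (t - u i) \<le> \<Phi> i t"
    using orlicz_subgradient[OF o] by metis
  then obtain s where s: "\<And>i t. \<Phi> i (u i) + s i * (t - u i) \<le> \<Phi> i t" by metis
  define g where "g z = (\<Sum>i<n. s i * z i)" for z :: "nat \<Rightarrow> real"
  define a where "a = g u"
  have "\<Phi> i (u i) \<le> s i * u i" for i
    using s[of i 0] o[of i] by (simp add: orlicz_def)
  then have "(\<Sum>i<n. \<Phi> i (u i)) \<le> a" unfolding a_def g_def by (intro sum_mono)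
  then have a: "a > 1" using n by simp
  \<comment> \<open>Summing the subgradient inequalities gives
    \<open>(\<Sum>i<n. \<Phi> i (u i)) + g t - a \<le> 1\<close>, and the first sum exceeds
    1.\<close>
  have le: "g t \<le> a" if t: "modular \<Phi> t \<le> 1" for t
  proof -
    have "(\<Sum>i<n. \<Phi> i (u i) + s i * (t i - u i)) \<le> (\<Sum>i<n. \<Phi> i (t i))"
      by (intro sum_mono s)
    also have "\<dots> \<le> 1" using t unfolding modular_le_1_iff[OF mo] by blast
    finally show ?thesis
      using n by (simp add: a_def g_def sum.distrib right_diff_distrib sum_subtractf)
  qed
  have g_scale: "g (\<lambda>i. c * z i) = c * g z" for c z
    by (simp add: g_def sum_distrib_left algebra_simps)
  have abs_le: "\<bar>g t\<bar> \<le> a" if t: "modular \<Phi> t \<le> 1" for t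
  proof -
    have "g (\<lambda>i. - t i) = - g t" using g_scale[of "-1" t] by simp
    then show ?thesis using le[OF t] le[of "\<lambda>i. - t i"] modular_neg[OF mo, of t] t by (simp add: abs_le_iff)
  qed
  have bound: "\<bar>g z\<bar> \<le> a * mo_norm \<Phi> z" if z: "z \<in> mo_space \<Phi>" for z
  proof (rule field_le_epsilon)
    fix e :: real assume "e > 0"
    define q where "q = mo_norm \<Phi> z + e / a"
    have q: "mo_norm \<Phi> z < q" using \<open>e > 0\<close> a by (simp add: q_def)
    then have "q > 0" using mo_norm_nonneg[OF mo z] by simp
    have "\<bar>g (\<lambda>i. (1 / q) * z i)\<bar> \<le> a"
      using abs_le[OF modular_le_1_if_norm_less[OF mo z q]] by simp
    then have "\<bar>g z\<bar> \<le> a * q"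
      unfolding g_scale using \<open>q > 0\<close> by (simp add: abs_mult divide_le_eq)
    then show "\<bar>g z\<bar> \<le> a * mo_norm \<Phi> z + e" using a by (simp add: q_def distrib_left)
  qed
  \<comment> \<open>Division by \<open>a\<close> makes the norm at most 1 and the value at
    \<open>u\<close> equal to 1, hence the value at \<open>x = r u\<close> equal to
    \<open>r\<close>.\<close>
  define \<psi> where "\<psi> = (\<lambda>z\<in>mo_space \<Phi>. \<Sum>i<n. s i / a * z i)"
  have val: "(\<Sum>i<n. s i / a * z i) = g z / a" for z
    by (simp add: g_def sum_divide_distrib)
  have bound': "\<bar>\<Sum>i<n. s i / a * z i\<bar> \<le> 1 * mo_norm \<Phi> z" if "z \<in> mo_space \<Phi>" for z
    unfolding val using bound[OF that] a by (simp add: abs_divide divide_le_eq mult.commute)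
  show ?thesis
  proof
    show "\<psi> \<in> predual \<Phi>"
      unfolding \<psi>_def by (rule finite_functional_in_predual[OF mo bound'])
    show "\<bar>\<psi> z\<bar> \<le> mo_norm \<Phi> z" if "z \<in> mo_space \<Phi>" for z
      using bound'[OF that] that by (simp add: \<psi>_def)
    have "x = (\<lambda>i. r * u i)" using r by (auto simp: u_def)
    then have "g x = r * a" using g_scale[of r u] by (simp add: a_def)
    moreover have "\<psi> x = g x / a" using x by (simp only: \<psi>_def restrict_apply' val)
    ultimately show "\<psi> x = r" using a by simp
  qed
qed

text \<open>A Cauchy sequence converges uniformly on bounded sets to its pointwise limit, and
  uniform limits preserve coordinatewise continuity there.\<close>

lemma predual_mcomplete:
  assumes mo: "musielak_orlicz \<Phi>"
  shows "Metric_space.mcomplete (predual \<Phi>) (dual_dist \<Phi>)"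
proof -
  interpret D: Metric_space "mo_dual \<Phi>" "dual_dist \<Phi>" by (rule dual_metric[OF mo])
  interpret P: Metric_space "predual \<Phi>" "dual_dist \<Phi>" by (rule D.subspace[OF predual_subset])
  show ?thesis
    unfolding P.mcomplete_def
  proof (intro allI impI)
    fix \<sigma> assume "P.MCauchy \<sigma>"
    then have \<sigma>: "\<And>k. \<sigma> k \<in> predual \<Phi>"
      and cauchy: "\<And>e. e > 0 \<Longrightarrow> \<exists>N. \<forall>n\<ge>N. \<forall>m\<ge>N. dual_dist \<Phi> (\<sigma> n) (\<sigma> m) < e"
      unfolding P.MCauchy_def by (auto 0 3)
    have \<sigma>D: "\<sigma> k \<in> mo_dual \<Phi>" for k using \<sigma> predual_subset by blast
    have unif: "\<exists>N. \<forall>n\<ge>N. \<forall>m\<ge>N. \<forall>x\<in>mo_space \<Phi>. \<bar>\<sigma> n x - \<sigma> m x\<bar> \<le> e * mo_norm \<Phi> x"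
      if "e > 0" for e
    proof -
      obtain N where N: "\<forall>n\<ge>N. \<forall>m\<ge>N. dual_dist \<Phi> (\<sigma> n) (\<sigma> m) < e" using cauchy[OF \<open>e > 0\<close>] by blast
      have "\<bar>\<sigma> n x - \<sigma> m x\<bar> \<le> e * mo_norm \<Phi> x" if "n \<ge> N" "m \<ge> N" "x \<in> mo_space \<Phi>" for n m x
        using dual_dist_apply[OF mo \<sigma>D \<sigma>D that(3), of n m] N that mo_norm_nonneg[OF mo that(3)]
        by (meson less_imp_le mult_right_mono order_trans)
      then show ?thesis by blast
    qed
    have "Cauchy (\<lambda>k. \<sigma> k x)" if x: "x \<in> mo_space \<Phi>" for x
    proof (rule CauchyI)
      fix e :: real assume "e > 0"
      define c where "c = mo_norm \<Phi> x + 1"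
      have c: "c > 0" "mo_norm \<Phi> x < c" using mo_norm_nonneg[OF mo x] by (auto simp: c_def)
      obtain N where N: "\<forall>n\<ge>N. \<forall>m\<ge>N. \<bar>\<sigma> n x - \<sigma> m x\<bar> \<le> e / c * mo_norm \<Phi> x"
        using unif[of "e / c"] \<open>e > 0\<close> c x by auto
      have "e / c * mo_norm \<Phi> x < e" using c \<open>e > 0\<close> by (simp add: divide_less_eq)
      then show "\<exists>M. \<forall>m\<ge>M. \<forall>n\<ge>M. norm (\<sigma> m x - \<sigma> n x) < e"
        using N by (metis le_less_trans real_norm_def)
    qed
    then have "\<forall>x\<in>mo_space \<Phi>. \<exists>l. (\<lambda>k. \<sigma> k x) \<longlonglongrightarrow> l"
      by (simp add: Cauchy_convergent_iff convergent_def)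
    then obtain g where g: "\<And>x. x \<in> mo_space \<Phi> \<Longrightarrow> (\<lambda>k. \<sigma> k x) \<longlonglongrightarrow> g x" by metis
    have lim: "\<bar>\<sigma> n x - g x\<bar> \<le> e * mo_norm \<Phi> x"
      if "\<forall>m\<ge>N. \<bar>\<sigma> n x - \<sigma> m x\<bar> \<le> e * mo_norm \<Phi> x" "x \<in> mo_space \<Phi>" for N n x e
    proof (rule tendsto_upperbound)
      show "(\<lambda>m. \<bar>\<sigma> n x - \<sigma> m x\<bar>) \<longlonglongrightarrow> \<bar>\<sigma> n x - g x\<bar>"
        by (intro tendsto_intros g that)
      show "eventually (\<lambda>m. \<bar>\<sigma> n x - \<sigma> m x\<bar> \<le> e * mo_norm \<Phi> x) sequentially"
        using that by (auto simp: eventually_sequentially)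
    qed simp
    define \<psi> where "\<psi> = restrict g (mo_space \<Phi>)"
    have limu: "\<exists>N. \<forall>n\<ge>N. \<forall>x\<in>mo_space \<Phi>. \<bar>\<sigma> n x - \<psi> x\<bar> \<le> e * mo_norm \<Phi> x" if "e > 0" for e
    proof -
      obtain N where "\<forall>n\<ge>N. \<forall>m\<ge>N. \<forall>x\<in>mo_space \<Phi>. \<bar>\<sigma> n x - \<sigma> m x\<bar> \<le> e * mo_norm \<Phi> x"
        using unif[OF \<open>e > 0\<close>] by blast
      then have "\<forall>n\<ge>N. \<forall>x\<in>mo_space \<Phi>. \<bar>\<sigma> n x - \<psi> x\<bar> \<le> e * mo_norm \<Phi> x"
        using lim[of N] by (simp add: \<psi>_def)
      then show ?thesis by blast
    qed
    have \<psi>D: "\<psi> \<in> mo_dual \<Phi>"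
    proof -
      obtain N where N: "\<forall>x\<in>mo_space \<Phi>. \<bar>\<sigma> N x - \<psi> x\<bar> \<le> 1 * mo_norm \<Phi> x" using limu[of 1] by auto
      obtain C where C: "\<forall>x\<in>mo_space \<Phi>. \<bar>\<sigma> N x\<bar> \<le> C * mo_norm \<Phi> x"
        using \<sigma>D[of N] by (auto simp: mo_dual_def)
      show ?thesis
        unfolding \<psi>_def
      proof (rule mo_dualI[OF mo, where C = "C + 1"])
        fix x y assume xy: "x \<in> mo_space \<Phi>" "y \<in> mo_space \<Phi>"
        have "(\<lambda>k. \<sigma> k x + \<sigma> k y) \<longlonglongrightarrow> g (\<lambda>i. x i + y i)"
          using g[OF mo_space_add[OF mo xy]] xy by (simp add: mo_dual_add[OF \<sigma>D])
        moreover have "(\<lambda>k. \<sigma> k x + \<sigma> k y) \<longlonglongrightarrow> g x + g y" by (intro tendsto_add g xy)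
        ultimately show "g (\<lambda>i. x i + y i) = g x + g y" by (rule LIMSEQ_unique)
      next
        fix c x assume x: "x \<in> mo_space \<Phi>"
        have "(\<lambda>k. c * \<sigma> k x) \<longlonglongrightarrow> g (\<lambda>i. c * x i)"
          using g[OF mo_space_scale[OF mo x]] x by (simp add: mo_dual_scale[OF \<sigma>D])
        moreover have "(\<lambda>k. c * \<sigma> k x) \<longlonglongrightarrow> c * g x" by (intro tendsto_mult tendsto_const g x)
        ultimately show "g (\<lambda>i. c * x i) = c * g x" by (rule LIMSEQ_unique)
      next
        fix x assume x: "x \<in> mo_space \<Phi>"
        have "\<bar>\<sigma> N x - g x\<bar> \<le> mo_norm \<Phi> x" "\<bar>\<sigma> N x\<bar> \<le> C * mo_norm \<Phi> x"
          using N C x by (auto simp: \<psi>_def)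
        then show "\<bar>g x\<bar> \<le> (C + 1) * mo_norm \<Phi> x" by (simp add: distrib_right)
      qed
    qed
    moreover have "(\<lambda>j. \<psi> (u j)) \<longlonglongrightarrow> \<psi> x"
      if u: "range u \<subseteq> mo_space \<Phi>" "\<forall>j. mo_norm \<Phi> (u j) \<le> B" "x \<in> mo_space \<Phi>"
        "\<forall>i. (\<lambda>j. u j i) \<longlonglongrightarrow> x i" for u :: "nat \<Rightarrow> nat \<Rightarrow> real" and x B
    proof (rule LIMSEQ_I)
      fix e :: real assume "e > 0"
      \<comment> \<open>\<open>K\<close> is positive and bounds the norms of \<open>x\<close> and
        all \<open>u j\<close>. On this ball \<open>\<sigma> n\<close> is within
        \<open>e / 4\<close> of \<open>\<psi>\<close>, so three errors of at most
        \<open>e / 4\<close> add up to less than \<open>e\<close>.\<close>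
      define K where "K = \<bar>B\<bar> + mo_norm \<Phi> x + 1"
      have K: "K > 0" using mo_norm_nonneg[OF mo u(3)] by (simp add: K_def)
      obtain n where n: "\<forall>z\<in>mo_space \<Phi>. \<bar>\<sigma> n z - \<psi> z\<bar> \<le> e / (4 * K) * mo_norm \<Phi> z"
        using limu[of "e / (4 * K)"] \<open>e > 0\<close> K by auto
      have small: "\<bar>\<sigma> n z - \<psi> z\<bar> \<le> e / 4" if z: "z \<in> mo_space \<Phi>" "mo_norm \<Phi> z \<le> K" for z
      proof -
        have "e / (4 * K) * mo_norm \<Phi> z \<le> e / (4 * K) * K"
          using \<open>e > 0\<close> K z by (intro mult_left_mono) auto
        also have "\<dots> = e / 4" using K by simp
        finally show ?thesis using n z(1) order_trans by blast
      qed
      have "(\<lambda>j. \<sigma> n (u j)) \<longlonglongrightarrow> \<sigma> n x"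
        using u by (intro predual_tendsto[OF \<sigma>]) auto
      then obtain M where M: "\<forall>j\<ge>M. norm (\<sigma> n (u j) - \<sigma> n x) < e / 4"
        using LIMSEQ_D[of _ _ "e / 4"] \<open>e > 0\<close> by fastforce
      have "norm (\<psi> (u j) - \<psi> x) < e" if "j \<ge> M" for j
      proof -
        have "mo_norm \<Phi> (u j) \<le> B" using u(2) by blast
        then have "mo_norm \<Phi> (u j) \<le> K" using mo_norm_nonneg[OF mo u(3)] by (simp add: K_def)
        then have "\<bar>\<sigma> n (u j) - \<psi> (u j)\<bar> \<le> e / 4" using u(1) by (intro small) auto
        moreover have "\<bar>\<sigma> n x - \<psi> x\<bar> \<le> e / 4" using u(3) by (intro small) (auto simp: K_def)
        moreover have "\<bar>\<sigma> n (u j) - \<sigma> n x\<bar> < e / 4" using M that by auto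
        ultimately show ?thesis using \<open>e > 0\<close> unfolding real_norm_def by linarith
      qed
      then show "\<exists>M. \<forall>j\<ge>M. norm (\<psi> (u j) - \<psi> x) < e" by blast
    qed
    ultimately have \<psi>: "\<psi> \<in> predual \<Phi>" unfolding predual_def by blast
    have "\<exists>N. \<forall>n\<ge>N. \<sigma> n \<in> predual \<Phi> \<and> dual_dist \<Phi> (\<sigma> n) \<psi> < e" if "e > 0" for e
    proof -
      obtain N where N: "\<forall>n\<ge>N. \<forall>x\<in>mo_space \<Phi>. \<bar>\<sigma> n x - \<psi> x\<bar> \<le> e / 2 * mo_norm \<Phi> x"
        using limu[of "e / 2"] \<open>e > 0\<close> by auto
      have "dual_dist \<Phi> (\<sigma> n) \<psi> < e" if "n \<ge> N" for n
        using dual_dist_le[OF mo \<sigma>D \<psi>D, of "e / 2" n] N that \<open>e > 0\<close> by fastforce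
      then show ?thesis using \<sigma> by blast
    qed
    then have "limitin P.mtopology \<sigma> \<psi> sequentially"
      using \<psi> by (simp add: P.limitin_metric eventually_sequentially)
    then show "\<exists>x. limitin P.mtopology \<sigma> x sequentially" by blast
  qed
qed

section \<open>Slices and cluster points of minimizing sequences\<close>

text \<open>\<open>F\<close> is the real-valued restriction of \<open>f\<close> to its effective
  domain \<open>S\<close>. Lower semicontinuity enters later, through the hypothesis
  \<open>lsc\<close> of \<open>minimizing_sequences_converge\<close>; this lets the locale be
  instantiated again with a linear perturbation of \<open>F\<close>.\<close>

locale mo_minimization =
  fixes \<Phi> :: "nat \<Rightarrow> real \<Rightarrow> real" and S :: "(nat \<Rightarrow> real) set" and F :: "(nat \<Rightarrow> real) \<Rightarrow> real"
    and B c :: real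
  assumes mo: "musielak_orlicz \<Phi>" "mo_nondegenerate \<Phi>"
    and S_subset: "S \<subseteq> mo_space \<Phi>" and S_ne: "S \<noteq> {}"
    and S_bounded: "x \<in> S \<Longrightarrow> mo_norm \<Phi> x \<le> B"
    and F_lower: "x \<in> S \<Longrightarrow> c \<le> F x"
begin

definition inf_val :: "((nat \<Rightarrow> real) \<Rightarrow> real) \<Rightarrow> real" where
  "inf_val \<phi> = (INF x\<in>S. F x - \<phi> x)"

definition slice :: "((nat \<Rightarrow> real) \<Rightarrow> real) \<Rightarrow> real \<Rightarrow> (nat \<Rightarrow> real) set" where
  "slice \<phi> \<delta> = {x \<in> S. F x - \<phi> x < inf_val \<phi> + \<delta>}"

definition small_slices :: "real \<Rightarrow> ((nat \<Rightarrow> real) \<Rightarrow> real) set" where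
  "small_slices e = {\<phi> \<in> mo_dual \<Phi>.
     \<exists>\<delta>>0. \<forall>x\<in>slice \<phi> \<delta>. \<forall>y\<in>slice \<phi> \<delta>. mo_norm \<Phi> (\<lambda>i. x i - y i) \<le> e}"

text \<open>Substitute for the minimizers of \<^term>\<open>\<lambda>x. F x - \<psi> x\<close>, which need not exist.\<close>

definition cluster :: "((nat \<Rightarrow> real) \<Rightarrow> real) \<Rightarrow> (nat \<Rightarrow> real) set" where
  "cluster \<psi> = {x \<in> mo_space \<Phi>. \<exists>u. range u \<subseteq> S \<and> (\<forall>i. (\<lambda>j. u j i) \<longlonglongrightarrow> x i)
     \<and> (\<lambda>j. F (u j) - \<psi> (u j)) \<longlonglongrightarrow> inf_val \<psi>}"

text \<open>For fixed \<open>e > 0\<close> there are countably many such sets, and they cover the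
  predual once the rational sequences are dense, since clusters are nonempty.\<close>

definition cluster_near :: "real \<Rightarrow> rat list \<Rightarrow> ((nat \<Rightarrow> real) \<Rightarrow> real) set" where
  "cluster_near e l = {\<psi> \<in> predual \<Phi>. \<exists>x\<in>cluster \<psi>. mo_norm \<Phi> (\<lambda>i. x i - rat_seq l i) \<le> e}"

section \<open>Infima, minimizing sequences and their cluster points\<close>

lemma B_nonneg: "0 \<le> B"
proof -
  obtain x where "x \<in> S" using S_ne by blast
  then show ?thesis using S_bounded S_subset mo_norm_nonneg[OF mo(1)] by (meson order_trans subsetD)
qed

text \<open>On the bounded set \<open>S\<close> the functional is at most
  \<open>\<bar>C\<bar> * B\<close>, so \<open>F - \<phi>\<close> is bounded below and the real
  infimum is genuine. The absolute value is taken because \<open>C\<close> comes without a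
  sign.\<close>

lemma inf_val_le:
  assumes \<phi>: "\<phi> \<in> mo_dual \<Phi>" and x: "x \<in> S"
  shows "inf_val \<phi> \<le> F x - \<phi> x"
proof -
  obtain C where C: "\<forall>x\<in>mo_space \<Phi>. \<bar>\<phi> x\<bar> \<le> C * mo_norm \<Phi> x"
    using \<phi> by (auto simp: mo_dual_def)
  have "c - \<bar>C\<bar> * B \<le> F y - \<phi> y" if y: "y \<in> S" for y
  proof -
    have "\<phi> y \<le> C * mo_norm \<Phi> y" using C y S_subset by (auto simp: abs_le_iff)
    also have "\<dots> \<le> \<bar>C\<bar> * mo_norm \<Phi> y"
      using y S_subset mo_norm_nonneg[OF mo(1)] by (intro mult_right_mono) auto
    also have "\<dots> \<le> \<bar>C\<bar> * B" using S_bounded[OF y] by (intro mult_left_mono) auto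
    finally show ?thesis using F_lower[OF y] by simp
  qed
  then have "bdd_below ((\<lambda>x. F x - \<phi> x) ` S)" by (rule bdd_belowI2)
  then show ?thesis unfolding inf_val_def using x by (rule cINF_lower)
qed

lemma slice_ne:
  assumes "\<phi> \<in> mo_dual \<Phi>" "\<delta> > 0"
  obtains x where "x \<in> slice \<phi> \<delta>"
proof -
  have "\<not> inf_val \<phi> + \<delta> \<le> inf_val \<phi>" using assms(2) by simp
  then have "\<not> (\<forall>x\<in>S. inf_val \<phi> + \<delta> \<le> F x - \<phi> x)"
    unfolding inf_val_def using S_ne by (meson cINF_greatest)
  then show ?thesis using that by (auto simp: slice_def not_le)
qed

lemma minimizing_sequence:
  assumes \<phi>: "\<phi> \<in> mo_dual \<Phi>"
  obtains u where "\<And>j. u j \<in> slice \<phi> (1 / (real j + 1))" "range u \<subseteq> S"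
    "(\<lambda>j. F (u j) - \<phi> (u j)) \<longlonglongrightarrow> inf_val \<phi>"
proof -
  have "\<forall>j. \<exists>x. x \<in> slice \<phi> (1 / (real j + 1))"
  proof
    fix j :: nat
    show "\<exists>x. x \<in> slice \<phi> (1 / (real j + 1))"
      by (rule slice_ne[OF \<phi>, of "1 / (real j + 1)"]) auto
  qed
  then obtain u where u: "\<And>j. u j \<in> slice \<phi> (1 / (real j + 1))" by metis
  have S: "u j \<in> S" for j using u[of j] by (simp add: slice_def)
  have "(\<lambda>j. F (u j) - \<phi> (u j)) \<longlonglongrightarrow> inf_val \<phi>"
  proof (rule tendsto_sandwich)
    show "\<forall>\<^sub>F j in sequentially. inf_val \<phi> \<le> F (u j) - \<phi> (u j)"
      using inf_val_le[OF \<phi> S] by simp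
    show "\<forall>\<^sub>F j in sequentially. F (u j) - \<phi> (u j) \<le> inf_val \<phi> + 1 / (real j + 1)"
      using u by (simp add: slice_def less_imp_le)
    show "(\<lambda>j. inf_val \<phi>) \<longlonglongrightarrow> inf_val \<phi>" by simp
    have "(\<lambda>j. 1 / (real j + 1)) \<longlonglongrightarrow> 0"
      using LIMSEQ_inverse_real_of_nat by (simp add: inverse_eq_divide add.commute)
    then show "(\<lambda>j. inf_val \<phi> + 1 / (real j + 1)) \<longlonglongrightarrow> inf_val \<phi>"
      using tendsto_add[OF tendsto_const, of _ 0 sequentially "inf_val \<phi>"] by simp
  qed
  then show ?thesis using that u S by blast
qed

lemma cluster_ne:
  assumes \<psi>: "\<psi> \<in> mo_dual \<Phi>"
  obtains x where "x \<in> cluster \<psi>"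
proof -
  obtain u where "\<And>j. u j \<in> slice \<psi> (1 / (real j + 1))"
    and u: "range u \<subseteq> S" "(\<lambda>j. F (u j) - \<psi> (u j)) \<longlonglongrightarrow> inf_val \<psi>"
    by (rule minimizing_sequence[OF \<psi>], rule that)
  have us: "range u \<subseteq> mo_space \<Phi>" "\<And>j. mo_norm \<Phi> (u j) \<le> B"
    using u(1) S_subset S_bounded by auto
  obtain x r where r: "strict_mono r" "x \<in> mo_space \<Phi>" "mo_norm \<Phi> x \<le> B" "\<And>i. (\<lambda>j. u (r j) i) \<longlonglongrightarrow> x i"
    by (rule bounded_seq_coordinatewise_convergent[OF mo us], rule that)
  have "(\<lambda>j. F (u (r j)) - \<psi> (u (r j))) \<longlonglongrightarrow> inf_val \<psi>"
    using LIMSEQ_subseq_LIMSEQ[OF u(2) r(1)] by (simp add: comp_def)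
  then have "x \<in> cluster \<psi>"
    unfolding cluster_def using r u(1) by (auto intro!: exI[of _ "\<lambda>j. u (r j)"])
  then show ?thesis by (rule that)
qed

text \<open>The concave function \<^const>\<open>inf_val\<close> has the points of \<^term>\<open>cluster \<psi>\<close> as (negated) supergradients
  at \<^term>\<open>\<psi>\<close>.\<close>

lemma inf_val_cluster_le:
  assumes \<psi>: "\<psi> \<in> predual \<Phi>" "\<theta> \<in> predual \<Phi>" and x: "x \<in> cluster \<psi>"
  shows "inf_val \<theta> \<le> inf_val \<psi> + (\<psi> x - \<theta> x)"
proof -
  obtain u where u: "range u \<subseteq> S" "\<And>i. (\<lambda>j. u j i) \<longlonglongrightarrow> x i"
      "(\<lambda>j. F (u j) - \<psi> (u j)) \<longlonglongrightarrow> inf_val \<psi>" and xm: "x \<in> mo_space \<Phi>"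
    using x unfolding cluster_def by blast
  have us: "range u \<subseteq> mo_space \<Phi>" "\<And>j. mo_norm \<Phi> (u j) \<le> B"
    using u(1) S_subset S_bounded by auto
  \<comment> \<open>\<open>F - \<theta>\<close> is split as
    \<open>(F - \<psi>) + (\<psi> - \<theta>)\<close>: the first part tends to the infimum, the
    second converges because both functionals are in the predual.\<close>
  have "(\<lambda>j. (F (u j) - \<psi> (u j)) + (\<psi> (u j) - \<theta> (u j))) \<longlonglongrightarrow> inf_val \<psi> + (\<psi> x - \<theta> x)"
    by (intro tendsto_add tendsto_diff u predual_tendsto[OF _ us xm] \<psi>)
  then show ?thesis
  proof (rule tendsto_lowerbound)
    have "inf_val \<theta> \<le> F (u j) - \<psi> (u j) + (\<psi> (u j) - \<theta> (u j))" for j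
      using inf_val_le[of \<theta> "u j"] \<psi>(2) predual_subset u(1) by fastforce
    then show "\<forall>\<^sub>F j in sequentially. inf_val \<theta> \<le> F (u j) - \<psi> (u j) + (\<psi> (u j) - \<theta> (u j))"
      by simp
  qed simp
qed

text \<open>If clusters within \<^term>\<open>e\<close> of a fixed point \<^term>\<open>q\<close> occur densely around \<^term>\<open>\<psi>\<close>, then
  \<open>inf_val + q\<close> is \<^term>\<open>e\<close>-Lipschitz there, which bounds every approximate supergradient.\<close>

lemma slice_near_rat_seq:
  assumes \<psi>: "\<psi> \<in> predual \<Phi>" and \<rho>: "\<rho> > 0" and e: "e > 0"
    and dense: "\<And>\<theta> \<eta>. \<theta> \<in> predual \<Phi> \<Longrightarrow> dual_dist \<Phi> \<psi> \<theta> < \<rho> \<Longrightarrow> \<eta> > 0 \<Longrightarrow>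
        \<exists>\<theta>'\<in>cluster_near e l. dual_dist \<Phi> \<theta> \<theta>' < \<eta>"
    and z: "z \<in> slice \<psi> (e * \<rho> / 2)"
  shows "mo_norm \<Phi> (\<lambda>i. z i - rat_seq l i) \<le> 3 * e"
proof (rule ccontr)
  let ?q = "rat_seq l"
  define w where "w = (\<lambda>i. z i - ?q i)"
  assume "\<not> ?thesis"
  then have big: "3 * e < mo_norm \<Phi> w" by (simp add: w_def)
  have zS: "z \<in> S" and zm: "z \<in> mo_space \<Phi>" using z S_subset by (auto simp: slice_def)
  have qm: "?q \<in> mo_space \<Phi>" by (rule rat_seq_in_mo_space[OF mo(1)])
  have wm: "w \<in> mo_space \<Phi>" unfolding w_def by (rule mo_space_diff[OF mo(1) zm qm])
  have \<psi>D: "\<psi> \<in> mo_dual \<Phi>" using \<psi> predual_subset by blast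
  have dd: "0 \<le> dual_dist \<Phi> \<alpha> \<beta>" for \<alpha> \<beta>
    by (rule Metric_space.nonneg[OF dual_metric[OF mo(1)]])
  obtain h where h: "h \<in> predual \<Phi>" "\<And>y. y \<in> mo_space \<Phi> \<Longrightarrow> \<bar>h y\<bar> \<le> mo_norm \<Phi> y" "h w = 3 * e"
    using predual_norming[OF mo(1) wm _ big] e by auto
  \<comment> \<open>\<open>\<psi>\<close> is moved by half the radius in the direction
    \<open>h\<close> that detects the large vector \<open>w\<close>.\<close>
  define \<theta> where "\<theta> = lin_comb \<Phi> \<psi> (\<rho> / 2) h"
  have \<theta>: "\<theta> \<in> predual \<Phi>" unfolding \<theta>_def by (rule lin_comb_in_predual[OF mo(1) \<psi> h(1)])
  then have \<theta>D: "\<theta> \<in> mo_dual \<Phi>" using predual_subset by blast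
  have \<theta>_apply: "\<theta> y = \<psi> y + \<rho> / 2 * h y" if "y \<in> mo_space \<Phi>" for y
    using that by (simp add: \<theta>_def lin_comb_apply)
  have "dual_dist \<Phi> \<psi> \<theta> \<le> \<rho> / 2"
  proof (rule dual_dist_le[OF mo(1) \<psi>D \<theta>D])
    fix y assume y: "y \<in> mo_space \<Phi>"
    have "\<rho> / 2 * \<bar>h y\<bar> \<le> \<rho> / 2 * mo_norm \<Phi> y" using h(2)[OF y] \<rho> by (intro mult_left_mono) auto
    then show "\<bar>\<psi> y - \<theta> y\<bar> \<le> \<rho> / 2 * mo_norm \<Phi> y"
      using \<rho> by (simp add: \<theta>_apply[OF y] abs_mult)
  qed (use \<rho> in simp)
  then have \<psi>\<theta>: "dual_dist \<Phi> \<psi> \<theta> < \<rho>" "dual_dist \<Phi> \<psi> \<theta> \<le> \<rho> / 2" using \<rho> by auto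
  \<comment> \<open>Chosen so that the errors of replacing \<open>\<theta>\<close> by
    \<open>\<theta>'\<close>, at most \<open>\<eta>\<close> times the norm of \<open>w\<close> plus
    \<open>\<eta> * e\<close>, total \<open>e * \<rho> / 2\<close>.\<close>
  define \<eta> where "\<eta> = e * \<rho> / 2 / (e + mo_norm \<Phi> w)"
  have den: "e + mo_norm \<Phi> w > 0" using big e by linarith
  then have \<eta>: "\<eta> > 0" "\<eta> * (e + mo_norm \<Phi> w) = e * \<rho> / 2"
    using e \<rho> nonzero_divide_eq_eq[of "e + mo_norm \<Phi> w" "e * \<rho> / 2" \<eta>]
    by (simp add: \<eta>_def, metis \<eta>_def less_irrefl)
  obtain \<theta>' where \<theta>'V: "\<theta>' \<in> cluster_near e l" and \<theta>\<theta>': "dual_dist \<Phi> \<theta> \<theta>' < \<eta>"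
    using dense[OF \<theta> \<psi>\<theta>(1) \<eta>(1)] by blast
  obtain x where \<theta>': "\<theta>' \<in> predual \<Phi>" and x: "x \<in> cluster \<theta>'" "mo_norm \<Phi> (\<lambda>i. x i - ?q i) \<le> e"
    using \<theta>'V by (auto simp: cluster_near_def)
  have \<theta>'D: "\<theta>' \<in> mo_dual \<Phi>" using \<theta>' predual_subset by blast
  have xm: "x \<in> mo_space \<Phi>" using x by (simp add: cluster_def)
  define v where "v = (\<lambda>i. x i - ?q i)"
  have vm: "v \<in> mo_space \<Phi>" unfolding v_def by (rule mo_space_diff[OF mo(1) xm qm])
  \<comment> \<open>The supergradient inequality at \<open>\<theta>'\<close>, the infimum tested at
    \<open>z\<close> and the slice condition on \<open>z\<close> show that
    \<open>\<theta>' - \<psi>\<close> grows from \<open>x\<close> to \<open>z\<close> by less than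
    \<open>e * \<rho> / 2\<close>.\<close>
  have "inf_val \<psi> \<le> inf_val \<theta>' + (\<theta>' x - \<psi> x)"
    by (rule inf_val_cluster_le[OF \<theta>' \<psi> x(1)])
  moreover have "inf_val \<theta>' \<le> F z - \<theta>' z" by (rule inf_val_le[OF \<theta>'D zS])
  moreover have "F z - \<psi> z < inf_val \<psi> + e * \<rho> / 2" using z by (simp add: slice_def)
  ultimately have main: "(\<theta>' z - \<psi> z) - (\<theta>' x - \<psi> x) < e * \<rho> / 2" by linarith
  \<comment> \<open>As \<open>w - v = z - x\<close>, the growth can be measured from
    \<open>q\<close>: on \<open>w\<close> the perturbation is large, on \<open>v\<close>, of norm at
    most \<open>e\<close>, it is small.\<close>
  have lin: "\<alpha> w - \<alpha> v = \<alpha> z - \<alpha> x" if "\<alpha> \<in> mo_dual \<Phi>" for \<alpha>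
    using mo_dual_diff[OF mo(1) that zm qm] mo_dual_diff[OF mo(1) that xm qm]
    by (simp add: w_def v_def)
  have "(\<theta>' w - \<psi> w) - (\<theta>' v - \<psi> v) < e * \<rho> / 2"
    using main lin[OF \<theta>'D] lin[OF \<psi>D] by linarith
  moreover have "\<bar>\<theta> w - \<theta>' w\<bar> \<le> \<eta> * mo_norm \<Phi> w"
    using dual_dist_apply[OF mo(1) \<theta>D \<theta>'D wm] \<theta>\<theta>' mo_norm_nonneg[OF mo(1) wm]
    by (meson less_imp_le mult_right_mono order_trans)
  moreover have "\<theta> w - \<psi> w = \<rho> / 2 * (3 * e)" using \<theta>_apply[OF wm] h(3) by simp
  moreover have "\<bar>\<theta>' v - \<psi> v\<bar> \<le> (\<rho> / 2 + \<eta>) * e"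
  proof -
    have "dual_dist \<Phi> \<psi> \<theta>' \<le> \<rho> / 2 + \<eta>"
      using Metric_space.triangle[OF dual_metric[OF mo(1)] \<psi>D \<theta>D \<theta>'D] \<psi>\<theta>(2) \<theta>\<theta>' by linarith
    then have "dual_dist \<Phi> \<psi> \<theta>' * mo_norm \<Phi> v \<le> (\<rho> / 2 + \<eta>) * e"
      using x(2) dd mo_norm_nonneg[OF mo(1) vm] \<rho> \<eta>(1) by (intro mult_mono) (auto simp: v_def)
    then show ?thesis
      using dual_dist_apply[OF mo(1) \<psi>D \<theta>'D vm] by (simp add: abs_minus_commute)
  qed
  \<comment> \<open>By the choice of \<open>\<eta>\<close> the left side is exactly
    \<open>e * \<rho> / 2\<close>.\<close>
  ultimately have "\<rho> / 2 * (3 * e) - \<eta> * mo_norm \<Phi> w - (\<rho> / 2 + \<eta>) * e < e * \<rho> / 2"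
    by linarith
  then show False using \<eta>(2) e \<rho> by (simp add: algebra_simps)
qed

text \<open>Frontiers of closed sets are nowhere dense, so by Baire's theorem some small
  \<open>\<psi>\<close> avoids the frontiers of all closures \<open>C p\<close>. For every
  \<open>n\<close> it lies in some \<open>C (n, l)\<close>, hence in the interior, where
  \<open>slice_near_rat_seq\<close> applies. Avoiding frontiers makes one \<open>\<psi>\<close>
  serve all \<open>n\<close> at once.\<close>

lemma small_slices_predual:
  assumes h: "mo_h \<Phi> = mo_space \<Phi>" and e: "e > 0"
  obtains \<psi> where "\<psi> \<in> predual \<Phi>" "dual_dist \<Phi> (\<lambda>x\<in>mo_space \<Phi>. 0) \<psi> < e"
    "\<And>n. \<psi> \<in> small_slices (1 / (real n + 1))"
proof -
  interpret D: Metric_space "mo_dual \<Phi>" "dual_dist \<Phi>" by (rule dual_metric[OF mo(1)])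
  interpret P: Metric_space "predual \<Phi>" "dual_dist \<Phi>" by (rule D.subspace[OF predual_subset])
  \<comment> \<open>Slice points will be within \<open>3 * r n\<close> of a common point, so
    diameters are at most \<open>6 * r n\<close>.\<close>
  define r where "r n = 1 / (real n + 1) / 6" for n :: nat
  have r: "r n > 0" for n by (simp add: r_def)
  have sixths: "3 * (a / 6) + 3 * (a / 6) = a" for a :: real by simp
  define C where "C p = P.mtopology closure_of (case p of (n, l) \<Rightarrow> cluster_near (r n) l)" for p
  define G where "G = range (\<lambda>p. P.mtopology frontier_of C p)"
  \<comment> \<open>The interior of the frontier lies in the interior of the closed set
    \<open>C p\<close>, which the frontier excludes.\<close>
  have empty: "closedin P.mtopology T \<and> P.mtopology interior_of T = {}" if "T \<in> G" for T
  proof -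
    obtain p where T: "T = P.mtopology frontier_of C p" using \<open>T \<in> G\<close> by (auto simp: G_def)
    have "closedin P.mtopology (C p)" by (simp add: C_def)
    then have "T \<subseteq> C p" unfolding T by (rule frontier_of_subset_closedin)
    then have "P.mtopology interior_of T \<subseteq> P.mtopology interior_of C p" by (rule interior_of_mono)
    moreover have "P.mtopology interior_of T \<subseteq> T" by (rule interior_of_subset)
    moreover have "T \<inter> P.mtopology interior_of C p = {}" by (auto simp: T frontier_of_def)
    ultimately have "P.mtopology interior_of T = {}" by blast
    then show ?thesis by (simp add: T closedin_frontier_of)
  qed
  have "P.mtopology interior_of \<Union>G = {}"
    by (rule P.metric_Baire_category_alt[OF predual_mcomplete[OF mo(1)] _ empty]) (simp add: G_def)
  moreover have "(\<lambda>x\<in>mo_space \<Phi>. 0) \<in> P.mball (\<lambda>x\<in>mo_space \<Phi>. 0) e"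
    using e predual_zero[OF mo(1)] by (simp add: P.centre_in_mball_iff)
  ultimately have "\<not> P.mball (\<lambda>x\<in>mo_space \<Phi>. 0) e \<subseteq> \<Union>G"
    using interior_of_maximal[OF _ P.openin_mball] by blast
  then obtain \<psi> where "\<psi> \<in> P.mball (\<lambda>x\<in>mo_space \<Phi>. 0) e" and nG: "\<psi> \<notin> \<Union>G"
    by blast
  then have \<psi>: "\<psi> \<in> predual \<Phi>" "dual_dist \<Phi> (\<lambda>x\<in>mo_space \<Phi>. 0) \<psi> < e"
    by simp_all
  have \<psi>D: "\<psi> \<in> mo_dual \<Phi>" using \<psi> predual_subset by blast
  have "\<psi> \<in> small_slices (1 / (real n + 1))" for n
  proof -
    obtain x where x: "x \<in> cluster \<psi>" using cluster_ne[OF \<psi>D] by blast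
    then have xm: "x \<in> mo_space \<Phi>" by (simp add: cluster_def)
    obtain l where l: "mo_norm \<Phi> (\<lambda>i. x i - rat_seq l i) < r n"
      by (rule mo_h_rat_seq_approx[OF mo h xm r])
    then have "\<psi> \<in> cluster_near (r n) l"
      using \<psi>(1) x by (auto simp: cluster_near_def intro: less_imp_le)
    moreover have "cluster_near (r n) l \<subseteq> topspace P.mtopology" by (auto simp: cluster_near_def)
    ultimately have "\<psi> \<in> C (n, l)"
      unfolding C_def using closure_of_subset[of "cluster_near (r n) l" P.mtopology] by auto
    moreover have "\<psi> \<notin> P.mtopology frontier_of C (n, l)" using nG by (auto simp: G_def)
    moreover have "closedin P.mtopology (C (n, l))" by (simp add: C_def)
    ultimately have "\<psi> \<in> P.mtopology interior_of C (n, l)"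
      by (simp add: frontier_of_def closure_of_closedin)
    then obtain \<rho> where \<rho>: "\<rho> > 0" "P.mball \<psi> \<rho> \<subseteq> P.mtopology interior_of C (n, l)"
      using openin_interior_of[of P.mtopology "C (n, l)"] unfolding P.openin_mtopology by metis
    have dense: "\<exists>\<theta>'\<in>cluster_near (r n) l. dual_dist \<Phi> \<theta> \<theta>' < \<eta>"
      if "\<theta> \<in> predual \<Phi>" "dual_dist \<Phi> \<psi> \<theta> < \<rho>" "\<eta> > 0" for \<theta> \<eta>
    proof -
      have "\<theta> \<in> P.mball \<psi> \<rho>" using that \<psi>(1) by simp
      then have "\<theta> \<in> C (n, l)" using \<rho>(2) interior_of_subset[of P.mtopology "C (n, l)"] by auto
      then show ?thesis using that(3) unfolding C_def P.metric_closure_of by auto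
    qed
    have near: "mo_norm \<Phi> (\<lambda>i. z i - rat_seq l i) \<le> 3 * r n" if "z \<in> slice \<psi> (r n * \<rho> / 2)" for z
      by (rule slice_near_rat_seq[OF \<psi>(1) \<rho>(1) r dense that])
    have "mo_norm \<Phi> (\<lambda>i. y i - z i) \<le> 1 / (real n + 1)"
      if yz: "y \<in> slice \<psi> (r n * \<rho> / 2)" "z \<in> slice \<psi> (r n * \<rho> / 2)" for y z
    proof -
      have "mo_norm \<Phi> (\<lambda>i. y i - z i)
          \<le> mo_norm \<Phi> (\<lambda>i. y i - rat_seq l i) + mo_norm \<Phi> (\<lambda>i. rat_seq l i - z i)"
        using yz S_subset by (intro mo_norm_triangle_diff rat_seq_in_mo_space mo) (auto simp: slice_def)
      also have "\<dots> \<le> 3 * r n + 3 * r n"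
        using near[OF yz(1)] near[OF yz(2)] mo_norm_minus_commute[OF mo(1), of z "rat_seq l"] by simp
      also have "\<dots> = 1 / (real n + 1)" unfolding r_def by (rule sixths)
      finally show ?thesis .
    qed
    moreover have "r n * \<rho> / 2 > 0" using r \<rho>(1) by simp
    ultimately show ?thesis unfolding small_slices_def using \<psi>D by blast
  qed
  then show ?thesis using that \<psi> by blast
qed

text \<open>On \<open>S\<close> the two functionals differ by at most
  \<open>dual_dist \<Phi> \<phi> \<psi> * B\<close>, and so do the infima; the two errors together
  account for the factor 2.\<close>

lemma slice_perturb:
  assumes f: "\<phi> \<in> mo_dual \<Phi>" "\<psi> \<in> mo_dual \<Phi>" and d: "2 * dual_dist \<Phi> \<phi> \<psi> * B \<le> \<delta> - \<delta>'"
  shows "slice \<psi> \<delta>' \<subseteq> slice \<phi> \<delta>"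
proof
  fix x assume x: "x \<in> slice \<psi> \<delta>'"
  then have xS: "x \<in> S" by (simp add: slice_def)
  have *: "\<bar>\<phi> y - \<psi> y\<bar> \<le> dual_dist \<Phi> \<phi> \<psi> * B" if "y \<in> S" for y
    using dual_dist_apply[OF mo(1) f, of y] S_bounded[OF that] S_subset that
      Metric_space.nonneg[OF dual_metric[OF mo(1)], of \<phi> \<psi>]
    by (meson mult_left_mono order_trans subsetD)
  have "inf_val \<psi> - dual_dist \<Phi> \<phi> \<psi> * B \<le> inf_val \<phi>"
    unfolding inf_val_def[of \<phi>]
  proof (rule cINF_greatest[OF S_ne])
    fix y assume y: "y \<in> S"
    show "inf_val \<psi> - dual_dist \<Phi> \<phi> \<psi> * B \<le> F y - \<phi> y"
      using inf_val_le[OF f(2) y] *[OF y] by linarith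
  qed
  moreover have "F x - \<psi> x < inf_val \<psi> + \<delta>'" using x by (simp add: slice_def)
  ultimately show "x \<in> slice \<phi> \<delta>"
    using *[OF xS] d xS by (simp add: slice_def)
qed

lemma openin_small_slices: "openin (dual_top \<Phi>) (small_slices e)"
proof -
  interpret D: Metric_space "mo_dual \<Phi>" "dual_dist \<Phi>" by (rule dual_metric[OF mo(1)])
  have "\<exists>r>0. D.mball \<phi> r \<subseteq> small_slices e" if \<phi>: "\<phi> \<in> small_slices e" for \<phi>
  proof -
    obtain \<delta> where \<delta>: "\<delta> > 0" and sm: "\<forall>x\<in>slice \<phi> \<delta>. \<forall>y\<in>slice \<phi> \<delta>. mo_norm \<Phi> (\<lambda>i. x i - y i) \<le> e"
      and \<phi>D: "\<phi> \<in> mo_dual \<Phi>"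
      using \<phi> by (auto simp: small_slices_def)
    \<comment> \<open>This makes the loss in \<open>slice_perturb\<close> at most
      \<open>\<delta> / 2\<close>; \<open>B + 1\<close> is positive even if
      \<open>B = 0\<close>.\<close>
    define r where "r = \<delta> / (4 * (B + 1))"
    have r: "r > 0" using \<delta> B_nonneg by (simp add: r_def)
    have "\<psi> \<in> small_slices e" if "\<psi> \<in> D.mball \<phi> r" for \<psi>
    proof -
      have \<psi>: "\<psi> \<in> mo_dual \<Phi>" "dual_dist \<Phi> \<phi> \<psi> < r" using that by auto
      have "2 * dual_dist \<Phi> \<phi> \<psi> * B \<le> 2 * r * (B + 1)"
        using \<psi>(2) B_nonneg r by (intro mult_mono) auto
      also have "\<dots> = \<delta> - \<delta> / 2" using B_nonneg by (simp add: r_def field_simps)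
      finally have "slice \<psi> (\<delta> / 2) \<subseteq> slice \<phi> \<delta>" by (rule slice_perturb[OF \<phi>D \<psi>(1)])
      then show ?thesis
        unfolding small_slices_def using \<psi>(1) sm \<delta> half_gt_zero[OF \<delta>] by blast
    qed
    then show ?thesis using r by blast
  qed
  then show ?thesis
    unfolding dual_top_def D.openin_mtopology by (auto simp: small_slices_def)
qed

end

section \<open>Strong minima from small slices, and density\<close>

context mo_minimization
begin

lemma cauchy_minimizing_sequence:
  assumes \<phi>: "\<And>n. \<phi> \<in> small_slices (1 / (real n + 1))"
    and u: "range u \<subseteq> S" "(\<lambda>j. F (u j) - \<phi> (u j)) \<longlonglongrightarrow> inf_val \<phi>" and e: "e > 0"
  shows "\<exists>N. \<forall>j\<ge>N. \<forall>k\<ge>N. mo_norm \<Phi> (\<lambda>i. u j i - u k i) \<le> e"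
proof -
  obtain n where n: "1 / (real n + 1) < e"
    using reals_Archimedean[OF e] by (auto simp: inverse_eq_divide add.commute)
  obtain \<delta> where \<delta>: "\<delta> > 0"
      "\<And>x y. x \<in> slice \<phi> \<delta> \<Longrightarrow> y \<in> slice \<phi> \<delta> \<Longrightarrow> mo_norm \<Phi> (\<lambda>i. x i - y i) \<le> 1 / (real n + 1)"
    using \<phi>[of n] by (auto simp: small_slices_def)
  have "\<forall>\<^sub>F j in sequentially. F (u j) - \<phi> (u j) < inf_val \<phi> + \<delta>"
    using order_tendstoD(2)[OF u(2), of "inf_val \<phi> + \<delta>"] \<delta>(1) by simp
  then obtain N where "\<forall>j\<ge>N. u j \<in> slice \<phi> \<delta>"
    using u(1) by (auto simp: eventually_sequentially slice_def)
  then have "\<forall>j\<ge>N. \<forall>k\<ge>N. mo_norm \<Phi> (\<lambda>i. u j i - u k i) \<le> e"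
    using \<delta>(2) n by (meson less_imp_le order_trans)
  then show ?thesis by blast
qed

text \<open>Minimizing sequences eventually enter every slice, hence are Cauchy. Completeness gives
  one of them a limit \<open>z\<close>, and \<open>lsc\<close> makes \<open>z\<close> a
  minimizer.\<close>

lemma minimizing_sequences_converge:
  assumes \<phi>: "\<And>n. \<phi> \<in> small_slices (1 / (real n + 1))"
    and lsc: "\<And>u z. range u \<subseteq> S \<Longrightarrow> z \<in> mo_space \<Phi> \<Longrightarrow>
        (\<lambda>j. mo_norm \<Phi> (\<lambda>i. u j i - z i)) \<longlonglongrightarrow> 0 \<Longrightarrow>
        (\<lambda>j. F (u j) - \<phi> (u j)) \<longlonglongrightarrow> inf_val \<phi> \<Longrightarrow> z \<in> S \<and> F z - \<phi> z \<le> inf_val \<phi>"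
  obtains z where "z \<in> S" "F z - \<phi> z = inf_val \<phi>"
    "\<And>u. range u \<subseteq> S \<Longrightarrow> (\<lambda>j. F (u j) - \<phi> (u j)) \<longlonglongrightarrow> inf_val \<phi> \<Longrightarrow>
      (\<lambda>j. mo_norm \<Phi> (\<lambda>i. u j i - z i)) \<longlonglongrightarrow> 0"
proof -
  have \<phi>D: "\<phi> \<in> mo_dual \<Phi>" using \<phi>[of 0] by (simp add: small_slices_def)
  obtain u where "\<And>j. u j \<in> slice \<phi> (1 / (real j + 1))"
    and u: "range u \<subseteq> S" "(\<lambda>j. F (u j) - \<phi> (u j)) \<longlonglongrightarrow> inf_val \<phi>"
    by (rule minimizing_sequence[OF \<phi>D], rule that)
  have "range u \<subseteq> mo_space \<Phi>" using u(1) S_subset by auto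
  then obtain z where z: "z \<in> mo_space \<Phi>" "(\<lambda>j. mo_norm \<Phi> (\<lambda>i. u j i - z i)) \<longlonglongrightarrow> 0"
    by (rule mo_space_complete[OF mo _ cauchy_minimizing_sequence[OF \<phi> u]])
  have zS: "z \<in> S" and le: "F z - \<phi> z \<le> inf_val \<phi>" using lsc[OF u(1) z u(2)] by auto
  then have eq: "F z - \<phi> z = inf_val \<phi>" using inf_val_le[OF \<phi>D zS] by simp
  show ?thesis
  proof (rule that[OF zS eq])
    fix v assume v: "range v \<subseteq> S" "(\<lambda>j. F (v j) - \<phi> (v j)) \<longlonglongrightarrow> inf_val \<phi>"
    show "(\<lambda>j. mo_norm \<Phi> (\<lambda>i. v j i - z i)) \<longlonglongrightarrow> 0"
    proof (rule LIMSEQ_I)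
      fix e :: real assume e: "e > 0"
      \<comment> \<open>Interleaving \<open>v\<close> with the constant \<open>z\<close> gives again
        a minimizing sequence; being Cauchy, it brings \<open>v j\<close> close to
        \<open>z\<close>.\<close>
      define w where "w j = (if even j then v (j div 2) else z)" for j
      have w: "range w \<subseteq> S" using v(1) zS by (auto simp: w_def)
      have "(\<lambda>j. F (w j) - \<phi> (w j)) \<longlonglongrightarrow> inf_val \<phi>"
      proof (rule LIMSEQ_I)
        fix d :: real assume d: "d > 0"
        then obtain N where N: "\<forall>j\<ge>N. norm (F (v j) - \<phi> (v j) - inf_val \<phi>) < d"
          using LIMSEQ_D[OF v(2)] by blast
        have "norm (F (w j) - \<phi> (w j) - inf_val \<phi>) < d" if "j \<ge> 2 * N" for j
          using N eq d that by (auto simp: w_def)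
        then show "\<exists>M. \<forall>j\<ge>M. norm (F (w j) - \<phi> (w j) - inf_val \<phi>) < d" by blast
      qed
      then obtain N where N: "\<forall>j\<ge>N. \<forall>k\<ge>N. mo_norm \<Phi> (\<lambda>i. w j i - w k i) \<le> e / 2"
        using cauchy_minimizing_sequence[OF \<phi> w _ half_gt_zero[OF e]] by blast
      have "norm (mo_norm \<Phi> (\<lambda>i. v j i - z i) - 0) < e" if "j \<ge> N" for j
      proof -
        have "mo_norm \<Phi> (\<lambda>i. w (2 * j) i - w (2 * j + 1) i) \<le> e / 2" using N that by simp
        then have "mo_norm \<Phi> (\<lambda>i. v j i - z i) \<le> e / 2" by (simp add: w_def)
        moreover have "0 \<le> mo_norm \<Phi> (\<lambda>i. v j i - z i)"
          using v(1) z S_subset by (intro mo_norm_nonneg mo_space_diff mo) auto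
        ultimately show ?thesis using e by simp
      qed
      then show "\<exists>M. \<forall>j\<ge>M. norm (mo_norm \<Phi> (\<lambda>i. v j i - z i) - 0) < e" by blast
    qed
  qed
qed

text \<open>The Baire argument is applied to \<open>F - \<phi>\<close>, which is again bounded below
  on \<open>S\<close>. It yields a small \<open>\<psi>\<close>, and \<open>\<phi> + \<psi>\<close>
  is the required functional.\<close>

lemma small_slices_dense:
  assumes h: "mo_h \<Phi> = mo_space \<Phi>" and \<phi>: "\<phi> \<in> mo_dual \<Phi>" and e: "e > 0"
  obtains \<theta> where "\<And>n. \<theta> \<in> small_slices (1 / (real n + 1))" "dual_dist \<Phi> \<phi> \<theta> < e"
proof -
  obtain C where C: "\<forall>x\<in>mo_space \<Phi>. \<bar>\<phi> x\<bar> \<le> C * mo_norm \<Phi> x"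
    using \<phi> by (auto simp: mo_dual_def)
  interpret T: mo_minimization \<Phi> S "\<lambda>x. F x - \<phi> x" B "c - \<bar>C\<bar> * B"
  proof
    fix x assume x: "x \<in> S"
    have "\<phi> x \<le> C * mo_norm \<Phi> x" using C x S_subset by (auto simp: abs_le_iff)
    also have "\<dots> \<le> \<bar>C\<bar> * mo_norm \<Phi> x"
      using x S_subset mo_norm_nonneg[OF mo(1)] by (intro mult_right_mono) auto
    also have "\<dots> \<le> \<bar>C\<bar> * B" using S_bounded[OF x] by (intro mult_left_mono) auto
    finally show "c - \<bar>C\<bar> * B \<le> F x - \<phi> x" using F_lower[OF x] by simp
  qed (use mo S_subset S_ne S_bounded in auto)
  obtain \<psi> where \<psi>: "\<psi> \<in> predual \<Phi>" "dual_dist \<Phi> (\<lambda>x\<in>mo_space \<Phi>. 0) \<psi> < e"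
    and small: "\<And>n. \<psi> \<in> T.small_slices (1 / (real n + 1))"
    by (rule T.small_slices_predual[OF h e], rule that)
  have \<psi>D: "\<psi> \<in> mo_dual \<Phi>" using \<psi> predual_subset by blast
  define \<theta> where "\<theta> = lin_comb \<Phi> \<phi> 1 \<psi>"
  have \<theta>D: "\<theta> \<in> mo_dual \<Phi>" unfolding \<theta>_def by (rule lin_comb_in_mo_dual[OF mo(1) \<phi> \<psi>D])
  have ap: "\<theta> x = \<phi> x + \<psi> x" if "x \<in> mo_space \<Phi>" for x
    using that by (simp add: \<theta>_def lin_comb_apply)
  have ap_S: "\<theta> x = \<phi> x + \<psi> x" if "x \<in> S" for x
    using ap[of x] that S_subset by auto
  \<comment> \<open>On \<open>S\<close> one has \<open>F - \<theta> = (F - \<phi>) - \<psi>\<close>,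
    so the two instances of the locale share infima and slices.\<close>
  have "inf_val \<theta> = T.inf_val \<psi>"
    unfolding inf_val_def T.inf_val_def by (intro arg_cong[where f = Inf] image_cong refl) (simp add: ap_S)
  then have "slice \<theta> \<delta> = T.slice \<psi> \<delta>" for \<delta>
    unfolding slice_def T.slice_def by (intro Collect_cong conj_cong refl) (simp add: ap_S diff_diff_eq)
  then have "\<theta> \<in> small_slices (1 / (real n + 1))" for n
    using small[of n] \<theta>D by (simp add: small_slices_def T.small_slices_def)
  moreover have "dual_dist \<Phi> \<phi> \<theta> \<le> dual_dist \<Phi> (\<lambda>x\<in>mo_space \<Phi>. 0) \<psi>"
  proof (rule dual_dist_le[OF mo(1) \<phi> \<theta>D])
    show "0 \<le> dual_dist \<Phi> (\<lambda>x\<in>mo_space \<Phi>. 0) \<psi>"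
      by (rule Metric_space.nonneg[OF dual_metric[OF mo(1)]])
    fix x assume x: "x \<in> mo_space \<Phi>"
    show "\<bar>\<phi> x - \<theta> x\<bar> \<le> dual_dist \<Phi> (\<lambda>x\<in>mo_space \<Phi>. 0) \<psi> * mo_norm \<Phi> x"
      using dual_dist_apply[OF mo(1) mo_dual_zero[OF mo(1)] \<psi>D x] x by (simp add: ap)
  qed
  ultimately show ?thesis using that \<psi>(2) by fastforce
qed

end

section \<open>Generic strong minima for extended-real-valued functions\<close>

theorem theorem18:
  fixes \<Phi> :: "nat \<Rightarrow> real \<Rightarrow> real" and f :: "(nat \<Rightarrow> real) \<Rightarrow> ereal"
  assumes "musielak_orlicz \<Phi>" and "mo_nondegenerate \<Phi>"
    and "mo_h \<Phi> = mo_space \<Phi>"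
    and "\<forall>x\<in>mo_space \<Phi>. f x \<noteq> - \<infinity>"
    and "\<exists>x\<in>mo_space \<Phi>. f x < \<infinity>"
    and "lower_semicontinuous (mo_top \<Phi>) f"
    and "\<exists>c::real. \<forall>x\<in>mo_space \<Phi>. ereal c \<le> f x"
    and "\<exists>B::real. \<forall>x\<in>{x \<in> mo_space \<Phi>. f x < \<infinity>}. mo_norm \<Phi> x \<le> B"
  shows "\<exists>X0 \<subseteq> mo_dual \<Phi>.
    gdelta_in (dual_top \<Phi>) X0 \<and> dual_top \<Phi> closure_of X0 = mo_dual \<Phi> \<and>
    (\<forall>\<phi>\<in>X0. \<exists>z. strong_minimum \<Phi> (\<lambda>x. f x - ereal (\<phi> x)) z)"
proof -
  note mo = assms(1,2)
  obtain c where c: "\<And>x. x \<in> mo_space \<Phi> \<Longrightarrow> ereal c \<le> f x" using assms(7) by blast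
  obtain B where B: "\<forall>x\<in>{x \<in> mo_space \<Phi>. f x < \<infinity>}. mo_norm \<Phi> x \<le> B" using assms(8) by blast
  define S where "S = {x \<in> mo_space \<Phi>. f x < \<infinity>}"
  \<comment> \<open>\<open>real_of_ereal\<close> sends infinity to 0, so \<open>F\<close> represents
    \<open>f\<close> only on \<open>S\<close>.\<close>
  define F where "F x = real_of_ereal (f x)" for x
  have f_S: "f x = ereal (F x)" if "x \<in> S" for x
    using that c[of x] unfolding S_def F_def by (cases "f x") auto
  have f_not_S: "f x = \<infinity>" if "x \<in> mo_space \<Phi>" "x \<notin> S" for x
    using that by (auto simp: S_def)
  interpret mo_minimization \<Phi> S F B c
  proof
    show "c \<le> F x" if "x \<in> S" for x
      using c[of x] f_S[OF that] that by (simp add: S_def)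
  qed (use mo assms(5) B in \<open>auto simp: S_def\<close>)
  interpret D: Metric_space "mo_dual \<Phi>" "dual_dist \<Phi>" by (rule dual_metric[OF mo(1)])
  interpret M: Metric_space "mo_space \<Phi>" "mo_dist \<Phi>" by (rule mo_metric[OF mo])
  define X0 where "X0 = (\<Inter>n. small_slices (1 / (real n + 1)))"
  have sub: "X0 \<subseteq> mo_dual \<Phi>" by (auto simp: X0_def small_slices_def)
  have "gdelta_in (dual_top \<Phi>) X0"
    unfolding X0_def by (rule gdelta_in_Inter) (auto intro: open_imp_gdelta_in openin_small_slices)
  moreover have "dual_top \<Phi> closure_of X0 = mo_dual \<Phi>"
    unfolding dual_top_def D.metric_closure_of
  proof (intro equalityI subsetI CollectI conjI allI impI)
    fix \<phi> and e :: real assume \<phi>: "\<phi> \<in> mo_dual \<Phi>" and e: "e > 0"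
    obtain \<theta> where "\<And>n. \<theta> \<in> small_slices (1 / (real n + 1))" "dual_dist \<Phi> \<phi> \<theta> < e"
      by (rule small_slices_dense[OF assms(3) \<phi> e], rule that)
    then show "\<exists>\<theta>\<in>X0. \<theta> \<in> D.mball \<phi> e"
      using sub \<phi> by (intro bexI[of _ \<theta>]) (auto simp: X0_def small_slices_def)
  qed auto
  moreover have "\<exists>z. strong_minimum \<Phi> (\<lambda>x. f x - ereal (\<phi> x)) z" if \<phi>X: "\<phi> \<in> X0" for \<phi>
  proof -
    have \<phi>: "\<phi> \<in> small_slices (1 / (real n + 1))" for n using \<phi>X by (simp add: X0_def)
    have \<phi>D: "\<phi> \<in> mo_dual \<Phi>" using \<phi>X sub by blast
    let ?g = "\<lambda>x. f x - ereal (\<phi> x)"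
    have lsc: "z \<in> S \<and> F z - \<phi> z \<le> inf_val \<phi>"
      if u: "range u \<subseteq> S" and z: "z \<in> mo_space \<Phi>"
        and uz: "(\<lambda>j. mo_norm \<Phi> (\<lambda>i. u j i - z i)) \<longlonglongrightarrow> 0"
        and lim: "(\<lambda>j. F (u j) - \<phi> (u j)) \<longlonglongrightarrow> inf_val \<phi>" for u z
    proof -
      have uS: "u j \<in> S" and um: "u j \<in> mo_space \<Phi>" for j using u S_subset by auto
      have "(\<lambda>j. \<phi> (u j) - \<phi> z) \<longlonglongrightarrow> 0"
      proof (rule Lim_null_comparison)
        \<comment> \<open>The dual norm of \<open>\<phi>\<close>, written as its distance from the
          zero functional.\<close>
        let ?K = "dual_dist \<Phi> \<phi> (\<lambda>x\<in>mo_space \<Phi>. 0)"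
        have "norm (\<phi> (u j) - \<phi> z) \<le> ?K * mo_norm \<Phi> (\<lambda>i. u j i - z i)" for j
          using dual_dist_apply[OF mo(1) \<phi>D mo_dual_zero[OF mo(1)] mo_space_diff[OF mo(1) um z], of j]
            mo_dual_diff[OF mo(1) \<phi>D um z, of j] mo_space_diff[OF mo(1) um z, of j] by simp
        then show "\<forall>\<^sub>F j in sequentially. norm (\<phi> (u j) - \<phi> z) \<le> ?K * mo_norm \<Phi> (\<lambda>i. u j i - z i)"
          by simp
        show "(\<lambda>j. ?K * mo_norm \<Phi> (\<lambda>i. u j i - z i)) \<longlonglongrightarrow> 0"
          using tendsto_mult[OF tendsto_const uz, of ?K] by simp
      qed
      then have "(\<lambda>j. (F (u j) - \<phi> (u j)) + (\<phi> (u j) - \<phi> z)) \<longlonglongrightarrow> inf_val \<phi> + 0"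
        by (intro tendsto_add lim)
      then have Flim: "(\<lambda>j. F (u j) - \<phi> z) \<longlonglongrightarrow> inf_val \<phi>" by simp
      \<comment> \<open>Otherwise lower semicontinuity keeps \<open>f\<close> above
        \<open>inf_val \<phi> + \<phi> z + e\<close> on a ball around \<open>z\<close>, which
        contains \<open>u j\<close> for large \<open>j\<close>, while \<open>F (u j)\<close> tends
        to \<open>inf_val \<phi> + \<phi> z\<close>.\<close>
      have "f z \<le> ereal (inf_val \<phi> + \<phi> z + e)" if e: "e > 0" for e
      proof (rule ccontr)
        assume "\<not> ?thesis"
        then have "z \<in> {x \<in> topspace (mo_top \<Phi>). ereal (inf_val \<phi> + \<phi> z + e) < f x}"
          using z by (simp add: topspace_mo_top[OF mo])
        moreover have "openin (mo_top \<Phi>) {x \<in> topspace (mo_top \<Phi>). ereal (inf_val \<phi> + \<phi> z + e) < f x}"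
          using assms(6) by (simp add: lower_semicontinuous_def)
        ultimately obtain r where r: "r > 0"
            "M.mball z r \<subseteq> {x \<in> topspace (mo_top \<Phi>). ereal (inf_val \<phi> + \<phi> z + e) < f x}"
          unfolding mo_top_def M.openin_mtopology by blast
        have "\<forall>\<^sub>F j in sequentially. mo_norm \<Phi> (\<lambda>i. u j i - z i) < r"
          by (rule order_tendstoD(2)[OF uz r(1)])
        moreover have "\<forall>\<^sub>F j in sequentially. F (u j) - \<phi> z < inf_val \<phi> + e"
          using order_tendstoD(2)[OF Flim, of "inf_val \<phi> + e"] e by simp
        ultimately have "\<forall>\<^sub>F j in sequentially. False"
        proof eventually_elim
          case (elim j)
          have "u j \<in> M.mball z r"
            using elim(1) um[of j] z mo_norm_minus_commute[OF mo(1), of "u j" z] by (simp add: mo_dist_def)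
          then have "ereal (inf_val \<phi> + \<phi> z + e) < f (u j)" using r(2) by blast
          then show False using f_S[OF uS] elim(2) by simp
        qed
        then show False by simp
      qed
      note fz = this
      \<comment> \<open>The bound with slack 1 already shows that \<open>f z\<close> is
        finite.\<close>
      have zS: "z \<in> S" using fz[of 1] z unfolding S_def by (auto intro: le_less_trans)
      have "F z - \<phi> z \<le> inf_val \<phi> + e" if "e > 0" for e
        using fz[OF that] f_S[OF zS] by simp
      then show ?thesis using zS field_le_epsilon by blast
    qed
    obtain z where z: "z \<in> S" "F z - \<phi> z = inf_val \<phi>"
      and conv: "\<And>u. range u \<subseteq> S \<Longrightarrow> (\<lambda>j. F (u j) - \<phi> (u j)) \<longlonglongrightarrow> inf_val \<phi> \<Longrightarrow>
        (\<lambda>j. mo_norm \<Phi> (\<lambda>i. u j i - z i)) \<longlonglongrightarrow> 0"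
    proof (rule minimizing_sequences_converge[of \<phi>])
      show "\<phi> \<in> small_slices (1 / (real n + 1))" for n by (rule \<phi>)
    qed (rule lsc that; assumption)+
    have gz: "?g z = ereal (inf_val \<phi>)" using f_S[OF z(1)] z(2) by simp
    have min: "?g z \<le> ?g x" if x: "x \<in> mo_space \<Phi>" for x
    proof (cases "x \<in> S")
      case True
      then show ?thesis using inf_val_le[OF \<phi>D True] f_S gz by simp
    next
      case False
      then show ?thesis using f_not_S[OF x] by simp
    qed
    have zm: "z \<in> mo_space \<Phi>" using z S_subset by blast
    have INF: "(INF x\<in>mo_space \<Phi>. ?g x) = ereal (inf_val \<phi>)"
      unfolding gz[symmetric] using zm min by (intro antisym INF_lower INF_greatest) auto
    have "(\<lambda>n. mo_norm \<Phi> (\<lambda>i. u n i - z i)) \<longlonglongrightarrow> 0"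
      if u: "range u \<subseteq> mo_space \<Phi>" "(\<lambda>n. ?g (u n)) \<longlonglongrightarrow> (INF x\<in>mo_space \<Phi>. ?g x)" for u
    proof -
      have lim: "(\<lambda>n. ?g (u n)) \<longlonglongrightarrow> ereal (inf_val \<phi>)" using u(2) INF by simp
      then have "\<forall>\<^sub>F n in sequentially. ?g (u n) < \<infinity>"
        by (rule order_tendstoD) simp
      then obtain N where N: "\<And>n. n \<ge> N \<Longrightarrow> ?g (u n) < \<infinity>"
        by (auto simp: eventually_sequentially)
      \<comment> \<open>Off \<open>S\<close> the objective is infinite, whereas a minimizing
        sequence has finite values eventually; so a tail lies in \<open>S\<close>.\<close>
      have uS: "u (n + N) \<in> S" for n
        using N[of "n + N"] f_not_S[of "u (n + N)"] u(1) by fastforce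
      have "(\<lambda>n. ?g (u (n + N))) \<longlonglongrightarrow> ereal (inf_val \<phi>)"
        using lim by (rule LIMSEQ_ignore_initial_segment)
      then have "(\<lambda>n. F (u (n + N)) - \<phi> (u (n + N))) \<longlonglongrightarrow> inf_val \<phi>"
        using f_S[OF uS] by simp
      then have "(\<lambda>n. mo_norm \<Phi> (\<lambda>i. u (n + N) i - z i)) \<longlonglongrightarrow> 0"
        using uS by (intro conv) auto
      then show ?thesis by (rule LIMSEQ_offset)
    qed
    then have "strong_minimum \<Phi> ?g z"
      unfolding strong_minimum_def using zm min by blast
    then show ?thesis by blast
  qed
  ultimately show ?thesis using sub by blast
qed

end
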